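(* Let $G$ be a connected chordal graph. The following are equivalent: (i) $G$ has a dominating clique; (ii) $\mathrm{diam}(G)\le 3$; (iii) $G\in \mathcal{G}^{\mathrm{cs}}$.
   Context: All graphs are finite and simple. A weight function on $V(G)$ is a map $w:V(G)\to\mathbb{R}_{>0}$; for $X\subseteq V(G)$ put $w(X)=\sum_{v\in X}w(v)$. A non-empty set $S\subseteq V(G)$ is a weighted safe set of $(G,w)$ if for every component $C$ of the induced subgraph $G[S]$ and every component $D$ of $G-S$ such that some edge joins $C$ and $D$, we have $w(C)\ge w(D)$. It is a connected weighted safe set if moreover $G[S]$ is connected. $\mathrm{s}(G,w)$ (resp. $\mathrm{cs}(G,w)$) is the minimum of $w(S)$ over all weighted safe sets (resp. connected weighted safe sets) $S$ of $(G,w)$. $\mathcal{G}^{\mathrm{cs}}$ denotes the family of all graphs $G$ such that $\mathrm{s}(G,w)=\mathrm{cs}(G,w)$ for every weight function $w$ on $V(G)$. A dominating clique is a set of vertices inducing a complete graph such that every vertex outside it has a neighbor in it. *)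

theory Defs
  imports Complex_Main
begin

record 'a graph =
  verts :: "'a set"
  edges :: "'a set set"

definition simple_graph :: "'a graph \<Rightarrow> bool" where
  "simple_graph G \<longleftrightarrow> finite (verts G) \<and> (\<forall>e \<in> edges G. e \<subseteq> verts G \<and> card e = 2)"

definition adjacent :: "'a graph \<Rightarrow> 'a \<Rightarrow> 'a \<Rightarrow> bool" where
  "adjacent G u v \<longleftrightarrow> {u, v} \<in> edges G"

definition induced :: "'a graph \<Rightarrow> 'a set \<Rightarrow> 'a graph" where
  "induced G S = \<lparr> verts = verts G \<inter> S, edges = {e \<in> edges G. e \<subseteq> S} \<rparr>"

definition delete_verts :: "'a graph \<Rightarrow> 'a set \<Rightarrow> 'a graph" where
  "delete_verts G S = induced G (verts G - S)"

definition reachable :: "'a graph \<Rightarrow> 'a \<Rightarrow> 'a \<Rightarrow> bool" where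
  "reachable G = (adjacent G)\<^sup>*\<^sup>*"

text \<open>The null graph is not connected.\<close>

definition graph_connected :: "'a graph \<Rightarrow> bool" where
  "graph_connected G \<longleftrightarrow> verts G \<noteq> {} \<and> (\<forall>u \<in> verts G. \<forall>v \<in> verts G. reachable G u v)"

text \<open>A component is represented by its vertex set.\<close>

definition graph_components :: "'a graph \<Rightarrow> 'a set set" where
  "graph_components G = (\<lambda>u. {v \<in> verts G. reachable G u v}) ` verts G"

text \<open>A cycle is represented by the list of its vertices in cyclic order.\<close>

definition cycle_edges :: "'a list \<Rightarrow> 'a set set" where
  "cycle_edges c = {{c ! i, c ! (Suc i mod length c)} | i. i < length c}"

definition is_cycle :: "'a graph \<Rightarrow> 'a list \<Rightarrow> bool" where
  "is_cycle G c \<longleftrightarrow> length c \<ge> 3 \<and> distinct c \<and> set c \<subseteq> verts G \<and> cycle_edges c \<subseteq> edges G"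

definition is_chord :: "'a graph \<Rightarrow> 'a list \<Rightarrow> 'a set \<Rightarrow> bool" where
  "is_chord G c e \<longleftrightarrow> e \<in> edges G \<and> e \<subseteq> set c \<and> e \<notin> cycle_edges c"

definition chordal :: "'a graph \<Rightarrow> bool" where
  "chordal G \<longleftrightarrow> (\<forall>c. is_cycle G c \<and> length c \<ge> 4 \<longrightarrow> (\<exists>e. is_chord G c e))"

text \<open>
  The distance is the least length of a walk, and the diameter the greatest distance. Both are
  meaningful only for connected graphs: the distance of vertices in different components and
  the diameter of the null graph are unspecified.
\<close>

definition graph_dist :: "'a graph \<Rightarrow> 'a \<Rightarrow> 'a \<Rightarrow> nat" where
  "graph_dist G u v = (LEAST n. (adjacent G ^^ n) u v)"

definition graph_diam :: "'a graph \<Rightarrow> nat" where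
  "graph_diam G = Max {graph_dist G u v | u v. u \<in> verts G \<and> v \<in> verts G}"

definition dominating_clique :: "'a graph \<Rightarrow> 'a set \<Rightarrow> bool" where
  "dominating_clique G K \<longleftrightarrow> K \<subseteq> verts G
     \<and> (\<forall>u \<in> K. \<forall>v \<in> K. u \<noteq> v \<longrightarrow> adjacent G u v)
     \<and> (\<forall>v \<in> verts G - K. \<exists>u \<in> K. adjacent G u v)"

definition weight_function :: "'a graph \<Rightarrow> ('a \<Rightarrow> real) \<Rightarrow> bool" where
  "weight_function G w \<longleftrightarrow> (\<forall>v \<in> verts G. w v > 0)"

definition weighted_safe_set :: "'a graph \<Rightarrow> ('a \<Rightarrow> real) \<Rightarrow> 'a set \<Rightarrow> bool" where
  "weighted_safe_set G w S \<longleftrightarrow> S \<noteq> {} \<and> S \<subseteq> verts G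
     \<and> (\<forall>C \<in> graph_components (induced G S). \<forall>D \<in> graph_components (delete_verts G S).
          (\<exists>x \<in> C. \<exists>y \<in> D. adjacent G x y) \<longrightarrow> sum w C \<ge> sum w D)"

definition connected_weighted_safe_set :: "'a graph \<Rightarrow> ('a \<Rightarrow> real) \<Rightarrow> 'a set \<Rightarrow> bool" where
  "connected_weighted_safe_set G w S \<longleftrightarrow>
     weighted_safe_set G w S \<and> graph_connected (induced G S)"

text \<open>
  Both minima are over finite sets. These are non-empty unless the graph is null: a component
  of maximum weight is a connected weighted safe set.
\<close>

definition safe_number :: "'a graph \<Rightarrow> ('a \<Rightarrow> real) \<Rightarrow> real" where
  "safe_number G w = Min {sum w S | S. weighted_safe_set G w S}"

definition connected_safe_number :: "'a graph \<Rightarrow> ('a \<Rightarrow> real) \<Rightarrow> real" where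
  "connected_safe_number G w = Min {sum w S | S. connected_weighted_safe_set G w S}"

definition Gcs :: "'a graph set" where
  "Gcs = {G. simple_graph G \<and>
     (\<forall>w. weight_function G w \<longrightarrow> safe_number G w = connected_safe_number G w)}"

end

theory Submission
  imports Defs
begin

text \<open>
  Chordality enters through two facts: the neighbours of a connected set that see a common vertex
  outside its closed neighbourhood form a clique, and (by deleting simplicial vertices) any family
  of pairwise touching connected sets is met by a single clique. If the diameter is at most 3, the
  closed neighbourhoods touch pairwise, and a clique meeting them all is dominating. Given a
  dominating clique, an exchange argument turns any safe set into a connected one that is not
  heavier. If two vertices are at distance at least 4, weights concentrated near them make
  every connected safe set pay for the part in between.
\<close>

section \<open>Connected vertex sets and components\<close>

text \<open>\<open>touching\<close> is the relation used for brambles. It replaces intersection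
  because closed neighbourhoods of vertices at distance 3 are disjoint. In a clique tree, connected
  vertex sets become subtrees, and two of them share a node exactly when the sets touch. Pairwise
  touching is thus the hypothesis of Helly's theorem, and a common node is the clique sought. In the
  exchange argument, supersets of a dominating clique are connected automatically, so only the
  weights of the leftover components need control. Distance at least 4 provides two separating
  cliques, inside the neighbourhoods of the two ends, that do not touch; this leaves a nonempty
  layer between them that a cheap connected safe set cannot afford to use.\<close>

definition clique :: "'a graph \<Rightarrow> 'a set \<Rightarrow> bool" where
  "clique G K \<longleftrightarrow> (\<forall>x\<in>K. \<forall>y\<in>K. x \<noteq> y \<longrightarrow> adjacent G x y)"

definition closed_nbhd :: "'a graph \<Rightarrow> 'a \<Rightarrow> 'a set" where
  "closed_nbhd G v = insert v {x. adjacent G v x}"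

definition touching :: "'a graph \<Rightarrow> 'a set \<Rightarrow> 'a set \<Rightarrow> bool" where
  "touching G A B \<longleftrightarrow> (\<exists>a\<in>A. \<exists>b\<in>B. a = b \<or> adjacent G a b)"

definition component_of :: "'a graph \<Rightarrow> 'a set \<Rightarrow> 'a \<Rightarrow> 'a set" where
  "component_of G S u = {v \<in> verts G \<inter> S. reachable (induced G S) u v}"

section \<open>Adjacency, induced subgraphs and reachability\<close>

lemma adjacent_sym: "adjacent G x y \<longleftrightarrow> adjacent G y x"
  by (simp add: adjacent_def insert_commute)

lemma adjacent_verts:
  assumes "simple_graph G" and "adjacent G x y"
  shows "x \<in> verts G" and "y \<in> verts G"
  using assms by (auto simp: simple_graph_def adjacent_def)

lemma adjacent_irrefl: "simple_graph G \<Longrightarrow> \<not> adjacent G x x"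
  by (force simp: simple_graph_def adjacent_def)

lemma closed_nbhd_verts: "simple_graph G \<Longrightarrow> v \<in> verts G \<Longrightarrow> closed_nbhd G v \<subseteq> verts G"
  by (auto simp: closed_nbhd_def dest: adjacent_verts)

lemma touching_sym: "touching G A B \<longleftrightarrow> touching G B A"
  unfolding touching_def by (metis adjacent_sym)

lemma adjacent_induced: "adjacent (induced G X) x y \<longleftrightarrow> adjacent G x y \<and> x \<in> X \<and> y \<in> X"
  by (auto simp: adjacent_def induced_def)

lemma verts_induced: "verts (induced G X) = verts G \<inter> X"
  by (simp add: induced_def)

lemma induced_verts: "simple_graph G \<Longrightarrow> induced G (verts G) = G"
  by (cases G) (auto simp: induced_def simple_graph_def)

lemma reachable_refl: "reachable G x x"
  by (simp add: reachable_def)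

lemma reachable_trans: "reachable G x y \<Longrightarrow> reachable G y z \<Longrightarrow> reachable G x z"
  by (simp add: reachable_def)

lemma reachable_adjacent: "adjacent G x y \<Longrightarrow> reachable G x y"
  by (auto simp: reachable_def)

lemma reachable_sym: "reachable G x y \<Longrightarrow> reachable G y x"
  unfolding reachable_def
  by (metis adjacent_sym symp_def symp_rtranclp)

lemma reachable_mono:
  assumes "reachable (induced G X) x y" and "X \<subseteq> Y"
  shows "reachable (induced G Y) x y"
proof -
  have "adjacent (induced G X) \<le> adjacent (induced G Y)"
    using assms(2) by (auto simp: adjacent_induced)
  then show ?thesis
    using assms(1) rtranclp_mono unfolding reachable_def by blast
qed

lemma reachable_closed:
  assumes "reachable (induced G Y) x y" and "x \<in> X"
    and "\<And>a b. a \<in> X \<Longrightarrow> b \<in> Y \<Longrightarrow> adjacent G a b \<Longrightarrow> b \<in> X"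
  shows "y \<in> X"
  using assms(1) unfolding reachable_def
  by (induction rule: rtranclp_induct) (use assms(2,3) in \<open>auto simp: adjacent_induced\<close>)

text \<open>Mostly used for contradictions: with \<open>verts G\<close> for \<open>Y\<close>, a
  nonempty proper set of vertices must have an edge leaving it.\<close>

lemma connected_closed:
  assumes "graph_connected (induced G Y)" and "Y \<subseteq> verts G" and "x \<in> X" and "x \<in> Y"
    and "\<And>a b. a \<in> X \<Longrightarrow> b \<in> Y \<Longrightarrow> adjacent G a b \<Longrightarrow> b \<in> X"
  shows "Y \<subseteq> X"
proof
  fix y assume "y \<in> Y"
  then have "reachable (induced G Y) x y"
    using assms(1,2,4) by (auto simp: graph_connected_def verts_induced)
  then show "y \<in> X" using assms(3,5) by (rule reachable_closed)
qed

section \<open>Connected vertex sets\<close>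

lemma connectedI:
  assumes "a \<in> X" and "X \<subseteq> verts G" and "\<And>x. x \<in> X \<Longrightarrow> reachable (induced G X) a x"
  shows "graph_connected (induced G X)"
  unfolding graph_connected_def verts_induced
proof (intro conjI ballI)
  show "verts G \<inter> X \<noteq> {}" using assms(1,2) by auto
  fix x y assume "x \<in> verts G \<inter> X" "y \<in> verts G \<inter> X"
  then show "reachable (induced G X) x y"
    using reachable_trans[OF reachable_sym[OF assms(3)] assms(3)] by blast
qed

lemma connectedD:
  assumes "graph_connected (induced G X)" and "X \<subseteq> verts G" and "x \<in> X" and "y \<in> X"
  shows "reachable (induced G X) x y"
  using assms by (auto simp: graph_connected_def verts_induced)

lemma connected_nonempty: "graph_connected (induced G X) \<Longrightarrow> X \<noteq> {}"
  by (auto simp: graph_connected_def verts_induced)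

lemma connected_Un:
  assumes X: "graph_connected (induced G X)" "X \<subseteq> verts G"
    and Y: "graph_connected (induced G Y)" "Y \<subseteq> verts G"
    and "touching G X Y"
  shows "graph_connected (induced G (X \<union> Y))"
proof -
  obtain x y where xy: "x \<in> X" "y \<in> Y" "x = y \<or> adjacent G x y"
    using assms(5) by (auto simp: touching_def)
  have xy': "reachable (induced G (X \<union> Y)) x y"
    using xy by (auto simp: adjacent_induced intro: reachable_refl reachable_adjacent)
  show ?thesis
  proof (rule connectedI)
    show "x \<in> X \<union> Y" "X \<union> Y \<subseteq> verts G" using xy X Y by auto
    fix z assume "z \<in> X \<union> Y"
    then consider "z \<in> X" | "z \<in> Y" by auto
    then show "reachable (induced G (X \<union> Y)) x z"
    proof cases
      case 1
      show ?thesis by (rule reachable_mono[OF connectedD[OF X xy(1) 1]]) simp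
    next
      case 2
      have "reachable (induced G (X \<union> Y)) y z"
        by (rule reachable_mono[OF connectedD[OF Y xy(2) 2]]) simp
      then show ?thesis by (rule reachable_trans[OF xy'])
    qed
  qed
qed

lemma connected_clique:
  assumes "clique G K" and "K \<subseteq> verts G" and "K \<noteq> {}"
  shows "graph_connected (induced G K)"
proof -
  obtain a where a: "a \<in> K" using assms(3) by auto
  show ?thesis
  proof (rule connectedI[OF a assms(2)])
    fix x assume "x \<in> K"
    then show "reachable (induced G K) a x"
      using a assms(1)
      by (cases "x = a") (auto simp: clique_def adjacent_induced intro: reachable_refl reachable_adjacent)
  qed
qed

lemma connected_singleton: "a \<in> verts G \<Longrightarrow> graph_connected (induced G {a})"
  by (rule connected_clique) (auto simp: clique_def)

lemma connected_insert:
  assumes "graph_connected (induced G X)" "X \<subseteq> verts G" "x \<in> X" "adjacent G x y" "y \<in> verts G"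
  shows "graph_connected (induced G (insert y X))"
proof -
  have "touching G X {y}" using assms by (auto simp: touching_def)
  then show ?thesis
    using connected_Un[OF assms(1,2) connected_singleton[OF assms(5)]] assms(5) by simp
qed

lemma connected_closed_nbhd:
  assumes "simple_graph G" and "v \<in> verts G"
  shows "graph_connected (induced G (closed_nbhd G v))"
proof (rule connectedI)
  show "v \<in> closed_nbhd G v" by (simp add: closed_nbhd_def)
  show "closed_nbhd G v \<subseteq> verts G" using assms by (rule closed_nbhd_verts)
  fix x assume "x \<in> closed_nbhd G v"
  then show "reachable (induced G (closed_nbhd G v)) v x"
    by (auto simp: closed_nbhd_def adjacent_induced intro: reachable_refl reachable_adjacent)
qed

section \<open>Components of induced subgraphs\<close>

lemma component_of_subset: "component_of G S u \<subseteq> S" "component_of G S u \<subseteq> verts G"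
  by (auto simp: component_of_def)

lemma component_of_mem: "u \<in> verts G \<Longrightarrow> u \<in> S \<Longrightarrow> u \<in> component_of G S u"
  by (auto simp: component_of_def reachable_refl)

lemma component_of_closed:
  assumes "x \<in> component_of G S u" and "y \<in> S" and "y \<in> verts G" and "adjacent G x y"
  shows "y \<in> component_of G S u"
proof -
  have "reachable (induced G S) x y"
    using assms by (intro reachable_adjacent) (auto simp: adjacent_induced component_of_def)
  then show ?thesis
    using assms reachable_trans[of _ u x y] by (simp add: component_of_def)
qed

text \<open>Upper bounds on the weight of a component come from here, lower bounds from
  \<open>component_of_maximal\<close>.\<close>

lemma component_of_subset_closed:
  assumes "u \<in> X" and "\<And>a b. a \<in> X \<Longrightarrow> b \<in> S \<Longrightarrow> adjacent G a b \<Longrightarrow> b \<in> X"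
  shows "component_of G S u \<subseteq> X"
proof
  fix y assume "y \<in> component_of G S u"
  then have "reachable (induced G S) u y" by (simp add: component_of_def)
  then show "y \<in> X" using assms by (rule reachable_closed)
qed

lemma component_of_eq:
  assumes "x \<in> component_of G S u"
  shows "component_of G S x = component_of G S u"
proof -
  have "reachable (induced G S) u x" using assms by (simp add: component_of_def)
  then have "reachable (induced G S) x v \<longleftrightarrow> reachable (induced G S) u v" for v
    using reachable_trans reachable_sym by metis
  then show ?thesis by (simp add: component_of_def)
qed

lemma component_of_maximal:
  assumes "graph_connected (induced G Y)" and "Y \<subseteq> verts G" and "u \<in> Y" and "Y \<subseteq> S"
  shows "Y \<subseteq> component_of G S u"
proof
  fix y assume y: "y \<in> Y"
  have "reachable (induced G S) u y"
    by (rule reachable_mono[OF connectedD[OF assms(1-3) y] assms(4)])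
  then show "y \<in> component_of G S u" using y assms by (auto simp: component_of_def)
qed

lemma connected_component_of:
  assumes "S \<subseteq> verts G" and "u \<in> S"
  shows "graph_connected (induced G (component_of G S u))"
proof (rule connectedI)
  let ?C = "component_of G S u"
  show u: "u \<in> ?C" using assms by (auto intro: component_of_mem)
  show "?C \<subseteq> verts G" by (rule component_of_subset)
  fix x assume "x \<in> ?C"
  \<comment> \<open>The given walk is only known to run in \<open>S\<close>; the invariant records
    that it never leaves the component.\<close>
  have "x \<in> {y \<in> ?C. reachable (induced G ?C) u y}"
  proof (rule reachable_closed)
    show "reachable (induced G S) u x" using \<open>x \<in> ?C\<close> by (simp add: component_of_def)
    show "u \<in> {y \<in> ?C. reachable (induced G ?C) u y}" using u by (simp add: reachable_refl)
    fix a b assume a: "a \<in> {y \<in> ?C. reachable (induced G ?C) u y}"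
      and b: "b \<in> S" "adjacent G a b"
    then have "b \<in> ?C"
      using component_of_closed[of a G S u b] assms(1) by auto
    moreover from this a b have "reachable (induced G ?C) a b"
      by (intro reachable_adjacent) (auto simp: adjacent_induced)
    ultimately show "b \<in> {y \<in> ?C. reachable (induced G ?C) u y}"
      using a reachable_trans[of _ u a b] by simp
  qed
  then show "reachable (induced G ?C) u x" by simp
qed

lemma component_of_connected:
  assumes "graph_connected (induced G T)" and "T \<subseteq> verts G" and "x \<in> T"
  shows "component_of G T x = T"
  using component_of_maximal[OF assms subset_refl] component_of_subset(1)[of G T x] by simp

lemma graph_components_induced:
  "graph_components (induced G S) = component_of G S ` (verts G \<inter> S)"
  by (auto simp: graph_components_def component_of_def verts_induced)

section \<open>Safe sets\<close>

lemma sum_weight_mono: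
  assumes "simple_graph G" and "weight_function G w" and "X \<subseteq> Y" and "Y \<subseteq> verts G"
  shows "sum w X \<le> sum w Y"
  using assms
  by (intro sum_mono2)
    (auto simp: simple_graph_def weight_function_def intro: finite_subset less_imp_le)

text \<open>Components joined by an edge are the components of the ends of that edge, so quantifying
  over edges suffices.\<close>

lemma weighted_safe_set_iff:
  assumes "simple_graph G"
  shows "weighted_safe_set G w S \<longleftrightarrow> S \<noteq> {} \<and> S \<subseteq> verts G \<and>
    (\<forall>x\<in>S. \<forall>y\<in>verts G - S. adjacent G x y \<longrightarrow>
       sum w (component_of G (verts G - S) y) \<le> sum w (component_of G S x))"
proof -
  have "(\<forall>C \<in> graph_components (induced G S). \<forall>D \<in> graph_components (delete_verts G S).
          (\<exists>x \<in> C. \<exists>y \<in> D. adjacent G x y) \<longrightarrow> sum w C \<ge> sum w D) \<longleftrightarrow>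
        (\<forall>x\<in>S. \<forall>y\<in>verts G - S. adjacent G x y \<longrightarrow>
          sum w (component_of G (verts G - S) y) \<le> sum w (component_of G S x))" (is "?L \<longleftrightarrow> ?R")
    if S: "S \<subseteq> verts G"
  proof
    assume L: ?L
    show ?R
    proof (intro ballI impI)
      fix x y assume x: "x \<in> S" and y: "y \<in> verts G - S" and xy: "adjacent G x y"
      have "x \<in> component_of G S x" "y \<in> component_of G (verts G - S) y"
        using x y S by (auto intro!: component_of_mem)
      moreover have "component_of G S x \<in> graph_components (induced G S)"
        "component_of G (verts G - S) y \<in> graph_components (delete_verts G S)"
        using x y S by (auto simp: graph_components_induced delete_verts_def)
      ultimately show "sum w (component_of G (verts G - S) y) \<le> sum w (component_of G S x)"
        using L xy by auto
    qed
  next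
    assume R: ?R
    show ?L
    proof (intro ballI impI)
      fix C D
      assume C: "C \<in> graph_components (induced G S)"
        and D: "D \<in> graph_components (delete_verts G S)"
        and "\<exists>x \<in> C. \<exists>y \<in> D. adjacent G x y"
      then obtain x y where xy: "x \<in> C" "y \<in> D" "adjacent G x y" by auto
      obtain a b where a: "C = component_of G S a" and b: "D = component_of G (verts G - S) b"
        using C D by (auto simp: graph_components_induced delete_verts_def)
      have "C = component_of G S x" "D = component_of G (verts G - S) y"
        using xy a b component_of_eq by metis+
      moreover have "x \<in> S" "y \<in> verts G - S"
        using xy a b by (auto simp: component_of_def)
      ultimately show "sum w C \<ge> sum w D" using R xy(3) by simp
    qed
  qed
  then show ?thesis unfolding weighted_safe_set_def by metis
qed

text \<open>In a connected graph every component of the complement has an edge to \<open>T\<close>,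
  and a connected \<open>T\<close> is its only component, so the adjacency condition
  disappears.\<close>

lemma connected_weighted_safe_set_iff:
  assumes G: "simple_graph G" "graph_connected G"
  shows "connected_weighted_safe_set G w T \<longleftrightarrow> T \<subseteq> verts G \<and> graph_connected (induced G T) \<and>
    (\<forall>y\<in>verts G - T. sum w (component_of G (verts G - T) y) \<le> sum w T)"
proof -
  have "sum w (component_of G (verts G - T) y) \<le> sum w T"
    if T: "T \<subseteq> verts G" "graph_connected (induced G T)" and y: "y \<in> verts G - T"
      and safe: "\<And>a b. a \<in> T \<Longrightarrow> b \<in> verts G - T \<Longrightarrow> adjacent G a b \<Longrightarrow>
         sum w (component_of G (verts G - T) b) \<le> sum w (component_of G T a)" for y
  proof -
    let ?D = "component_of G (verts G - T) y"
    have "\<exists>b\<in>?D. \<exists>a\<in>T. adjacent G b a"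
    proof (rule ccontr)
      assume no: "\<not> ?thesis"
      have "verts G \<subseteq> ?D"
      proof (rule connected_closed)
        show "graph_connected (induced G (verts G))" using G by (simp add: induced_verts)
        show "y \<in> ?D" using y by (auto intro: component_of_mem)
        fix a b assume "a \<in> ?D" "b \<in> verts G" "adjacent G a b"
        then show "b \<in> ?D" using no component_of_closed[of a G "verts G - T" y b] by auto
      qed (use y in auto)
      then show False
        using T connected_nonempty[of G T] component_of_subset(1)[of G "verts G - T" y] by auto
    qed
    then obtain a b where ab: "b \<in> ?D" "a \<in> T" "adjacent G a b" by (metis adjacent_sym)
    have b: "b \<in> verts G - T" using ab(1) by (auto simp: component_of_def)
    show ?thesis
      using safe[OF ab(2) b ab(3)] component_of_eq[OF ab(1)]
        component_of_connected[OF T(2,1) ab(2)] by simp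
  qed
  moreover have "sum w (component_of G (verts G - T) y) \<le> sum w (component_of G T x)"
    if "T \<subseteq> verts G" "graph_connected (induced G T)" "x \<in> T"
      "sum w (component_of G (verts G - T) y) \<le> sum w T" for x y
    using that component_of_connected[OF that(2,1,3)] by simp
  ultimately show ?thesis
    unfolding connected_weighted_safe_set_def weighted_safe_set_iff[OF G(1)]
    using connected_nonempty[of G T] by (intro iffI conjI ballI impI) auto
qed

text \<open>The source of lower bounds for connected safe sets: \<open>X\<close> lies inside one
  component of the complement.\<close>

lemma connected_safe_set_bound:
  assumes G: "simple_graph G" "graph_connected G" and w: "weight_function G w"
    and T: "connected_weighted_safe_set G w T"
    and X: "graph_connected (induced G X)" "X \<subseteq> verts G - T"
  shows "sum w X \<le> sum w T"
proof -
  obtain y where y: "y \<in> X" using connected_nonempty[OF X(1)] by auto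
  have "X \<subseteq> component_of G (verts G - T) y"
    using X y by (intro component_of_maximal) auto
  then have "sum w X \<le> sum w (component_of G (verts G - T) y)"
    using component_of_subset(2) by (rule sum_weight_mono[OF G(1) w])
  also have "\<dots> \<le> sum w T"
    using T y X(2) unfolding connected_weighted_safe_set_iff[OF G] by auto
  finally show ?thesis .
qed

lemma whole_graph_connected_safe:
  assumes "simple_graph G" "graph_connected G"
  shows "connected_weighted_safe_set G w (verts G)"
  using assms by (simp add: connected_weighted_safe_set_iff induced_verts)

lemma finite_safe_weights:
  assumes "simple_graph G"
  shows "finite {sum w S | S. weighted_safe_set G w S}"
    and "finite {sum w S | S. connected_weighted_safe_set G w S}"
proof -
  have "finite (sum w ` Pow (verts G))" using assms by (simp add: simple_graph_def)
  moreover have "{sum w S | S. weighted_safe_set G w S} \<subseteq> sum w ` Pow (verts G)"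
    by (auto simp: weighted_safe_set_def)
  ultimately show fin: "finite {sum w S | S. weighted_safe_set G w S}"
    by (rule finite_subset[rotated])
  show "finite {sum w S | S. connected_weighted_safe_set G w S}"
    by (rule finite_subset[OF _ fin]) (auto simp: connected_weighted_safe_set_def)
qed

text \<open>Both minima are attained, since \<open>verts G\<close> is itself a connected safe set.
  Connected safe sets are safe, so only one inequality has content.\<close>

lemma safe_numbers_eq_iff:
  assumes G: "simple_graph G" "graph_connected G"
  shows "safe_number G w = connected_safe_number G w \<longleftrightarrow>
    (\<forall>S. weighted_safe_set G w S \<longrightarrow> (\<exists>T. connected_weighted_safe_set G w T \<and> sum w T \<le> sum w S))"
    (is "?L \<longleftrightarrow> ?R")
proof -
  let ?s = "{sum w S | S. weighted_safe_set G w S}"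
  let ?c = "{sum w S | S. connected_weighted_safe_set G w S}"
  note fin = finite_safe_weights[OF G(1), of w]
  have c: "sum w (verts G) \<in> ?c" using whole_graph_connected_safe[OF G] by auto
  have sub: "?c \<subseteq> ?s" by (auto simp: connected_weighted_safe_set_def)
  have le: "Min ?s \<le> Min ?c" using sub c fin by (intro Min_antimono) auto
  show ?thesis
  proof
    assume L: ?L
    have "Min ?c \<in> ?c" using fin c by (intro Min_in) auto
    then obtain T where T: "connected_weighted_safe_set G w T" "Min ?c = sum w T" by auto
    have "sum w T \<le> sum w S" if "weighted_safe_set G w S" for S
    proof -
      have "Min ?s \<le> sum w S" using that fin by (intro Min_le) auto
      then show ?thesis using L T by (simp add: safe_number_def connected_safe_number_def)
    qed
    then show ?R using T by auto
  next
    assume R: ?R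
    have "Min ?s \<in> ?s" using fin c sub by (intro Min_in) auto
    then obtain S where S: "weighted_safe_set G w S" "Min ?s = sum w S" by auto
    obtain T where T: "connected_weighted_safe_set G w T" "sum w T \<le> sum w S" using R S by auto
    have "Min ?c \<le> sum w T" using fin T by (auto intro!: Min_le)
    then show ?L
      using le S T by (simp add: safe_number_def connected_safe_number_def)
  qed
qed

section \<open>Chordal graphs\<close>

text \<open>A repeated vertex or a shortcut could be spliced into a shorter walk. For a symmetric
  relation the forward shortcuts excluded here are all possible chords.\<close>

lemma shortest_walk:
  assumes "R\<^sup>*\<^sup>* s t"
  obtains n p where "p 0 = s" and "p n = t" and "\<And>i. i < n \<Longrightarrow> R (p i) (p (Suc i))"
    and "\<And>i j. i < j \<Longrightarrow> j \<le> n \<Longrightarrow> p i \<noteq> p j"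
    and "\<And>i j. Suc i < j \<Longrightarrow> j \<le> n \<Longrightarrow> \<not> R (p i) (p j)"
proof -
  define n where "n = (LEAST n. (R ^^ n) s t)"
  have n: "(R ^^ n) s t" unfolding n_def using rtranclp_imp_relpowp[OF assms] by (auto intro: LeastI)
  have least: "n \<le> m" if "(R ^^ m) s t" for m unfolding n_def using that by (rule Least_le)
  obtain p where p: "p 0 = s" "p n = t" "\<And>i. i < n \<Longrightarrow> R (p i) (p (Suc i))"
    using n by (auto simp: relpowp_fun_conv)
  have walk: "(R ^^ (j - i)) (p i) (p j)" if "i \<le> j" "j \<le> n" for i j
    unfolding relpowp_fun_conv using that p(3) by (intro exI[of _ "\<lambda>k. p (i + k)"]) auto
  have pre: "(R ^^ i) s (p i)" if "i \<le> n" for i using walk[of 0 i] that p(1) by simp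
  have post: "(R ^^ (n - j)) (p j) t" if "j \<le> n" for j using walk[of j n] that p(2) by simp
  have "p i \<noteq> p j" if "i < j" "j \<le> n" for i j
  proof
    assume "p i = p j"
    then have "(R ^^ (i + (n - j))) s t"
      using pre[of i] post[of j] that unfolding relpowp_add by auto
    then show False using least that by fastforce
  qed
  moreover have "\<not> R (p i) (p j)" if "Suc i < j" "j \<le> n" for i j
  proof
    assume "R (p i) (p j)"
    then have "(R ^^ Suc i) s (p j)" using pre[of i] that by auto
    then have "(R ^^ (Suc i + (n - j))) s t"
      using post[of j] that unfolding relpowp_add by blast
    then show False using least that by fastforce
  qed
  ultimately show thesis using that p by blast
qed

text \<open>
  Otherwise a shortest path from \<open>s\<close> to \<open>t\<close> through \<open>H\<close>, closed up by \<open>r\<close>, is a chordless cycle.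
\<close>

lemma chordal_adjacent:
  assumes G: "simple_graph G" "chordal G"
    and H: "graph_connected (induced G H)" "H \<subseteq> verts G"
    and r: "r \<notin> H" "\<And>h. h \<in> H \<Longrightarrow> \<not> adjacent G r h"
    and rs: "adjacent G r s" and rt: "adjacent G r t" and "s \<noteq> t"
    and sH: "touching G {s} H" and tH: "touching G {t} H"
  shows "adjacent G s t"
proof (rule ccontr)
  assume st: "\<not> adjacent G s t"
  have sV: "s \<in> verts G" and tV: "t \<in> verts G" and rV: "r \<in> verts G"
    using rs rt adjacent_verts[OF G(1)] by auto
  define X where "X = {s} \<union> H \<union> {t}"
  have "graph_connected (induced G ({s} \<union> H))"
    using sV H sH by (intro connected_Un connected_singleton) auto
  then have "graph_connected (induced G X)"
    unfolding X_def
  proof (rule connected_Un)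
    show "touching G ({s} \<union> H) {t}"
      using tH touching_sym[of G "{t}" H] by (auto simp: touching_def)
  qed (use sV H tV in \<open>auto intro: connected_singleton\<close>)
  then have "reachable (induced G X) s t"
    by (rule connectedD) (use sV tV H in \<open>auto simp: X_def\<close>)
  then obtain n p where p: "p 0 = s" "p n = t"
      "\<And>i. i < n \<Longrightarrow> adjacent (induced G X) (p i) (p (Suc i))"
      "\<And>i j. i < j \<Longrightarrow> j \<le> n \<Longrightarrow> p i \<noteq> p j"
      "\<And>i j. Suc i < j \<Longrightarrow> j \<le> n \<Longrightarrow> \<not> adjacent (induced G X) (p i) (p j)"
    unfolding reachable_def by (rule shortest_walk) blast
  have pX: "p i \<in> X" if "i \<le> n" for i
    using that p(1) p(3)[of "i - 1"] by (cases i) (auto simp: adjacent_induced X_def)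
  have n2: "2 \<le> n"
  proof (rule ccontr)
    assume "\<not> ?thesis"
    then have "n = 0 \<or> n = 1" by auto
    then show False using p(1-3) st \<open>s \<noteq> t\<close> by (auto simp: adjacent_induced)
  qed
  \<comment> \<open>Inner vertices differ from \<open>s\<close> and \<open>t\<close>, hence lie in
    \<open>H\<close>, where \<open>r\<close> has no neighbour.\<close>
  have pH: "p i \<in> H" if "0 < i" "i < n" for i
    using pX[of i] p(4)[of 0 i] p(4)[of i n] that p(1,2) by (auto simp: X_def)
  have pr: "p i \<noteq> r" if "i \<le> n" for i
    using pX[OF that] r(1) rs rt adjacent_irrefl[OF G(1)] by (auto simp: X_def)
  \<comment> \<open>With \<open>r\<close> at index \<open>Suc n\<close> the cycle has
    \<open>n + 2\<close>, hence at least 4, vertices, and its last edge wraps around from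
    \<open>r\<close> to \<open>p 0 = s\<close>.\<close>
  define c where "c = map p [0..<Suc n] @ [r]"
  have len: "length c = n + 2" by (simp add: c_def)
  have nth: "c ! i = p i" if "i \<le> n" for i
    using that by (simp add: c_def nth_append del: upt_Suc)
  have nth': "c ! Suc n = r" by (simp add: c_def nth_append del: upt_Suc)
  have set: "set c = insert r (p ` {..n})" by (auto simp: c_def less_Suc_eq_le simp del: upt_Suc)
  have "inj_on p {0..<Suc n}"
  proof (rule linorder_inj_onI')
    fix i j assume "i \<in> {0..<Suc n}" "j \<in> {0..<Suc n}" "i < j"
    then show "p i \<noteq> p j" using p(4) by simp
  qed
  then have dist: "distinct c"
    unfolding c_def using pr by (force simp: distinct_map less_Suc_eq_le simp del: upt_Suc)
  have edge: "{p i, p (Suc i)} \<in> cycle_edges c" if "i < n" for i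
    unfolding cycle_edges_def using that nth[of i] nth[of "Suc i"]
    by (auto simp: len intro!: exI[of _ i])
  have edge_t: "{p n, r} \<in> cycle_edges c"
    unfolding cycle_edges_def using nth[of n] nth'
    by (auto simp: len intro!: exI[of _ n])
  have edge_s: "{r, p 0} \<in> cycle_edges c"
    unfolding cycle_edges_def using nth[of 0] nth'
    by (auto simp: len intro!: exI[of _ "Suc n"])
  have "cycle_edges c \<subseteq> edges G"
  proof
    fix e assume "e \<in> cycle_edges c"
    then obtain i where i: "i < n + 2" "e = {c ! i, c ! (Suc i mod (n + 2))}"
      by (auto simp: cycle_edges_def len)
    then consider "i < n" | "i = n" | "i = Suc n" by linarith
    then show "e \<in> edges G"
    proof cases
      case 1
      then have "adjacent G (p i) (p (Suc i))" using p(3)[of i] by (simp add: adjacent_induced)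
      then show ?thesis using i 1 nth by (simp add: adjacent_def)
    next
      case 2
      then show ?thesis using i rt p(2) nth nth' by (simp add: adjacent_def insert_commute)
    next
      case 3
      then show ?thesis using i rs p(1) nth nth' by (simp add: adjacent_def insert_commute)
    qed
  qed
  moreover have "set c \<subseteq> verts G" using set pX rV sV tV H by (auto simp: X_def)
  ultimately have "is_cycle G c" using dist len n2 by (simp add: is_cycle_def)
  then obtain e where e: "e \<in> edges G" "e \<subseteq> set c" "e \<notin> cycle_edges c"
    using G(2) len n2 by (auto simp: chordal_def is_chord_def)
  have path_chord: False if ij: "i < j" "j \<le> n" and eq: "e = {p i, p j}" for i j
  proof (cases "j = Suc i")
    case True
    then show False using edge[of i] e(3) ij eq by auto
  next
    case False
    then have "\<not> adjacent (induced G X) (p i) (p j)" using p(5)[of i j] ij by auto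
    then show False using e(1) eq pX[of i] pX[of j] ij
      by (simp add: adjacent_induced) (simp add: adjacent_def)
  qed
  have r_chord: False if i: "i \<le> n" and eq: "e = {r, p i}" for i
  proof -
    consider "i = 0" | "i = n" | "0 < i" "i < n" using i by linarith
    then show False
    proof cases
      case 1
      then show False using edge_s e(3) eq by auto
    next
      case 2
      then show False using edge_t e(3) eq by (auto simp: insert_commute)
    next
      case 3
      then show False using pH[OF 3] r(2)[of "p i"] e(1) eq by (simp add: adjacent_def)
    qed
  qed
  obtain x y where xy: "e = {x, y}" "x \<noteq> y"
    using G(1) e(1) by (auto simp: simple_graph_def card_2_iff)
  then have "x \<in> insert r (p ` {..n})" "y \<in> insert r (p ` {..n})" using e(2) set by auto
  then consider i where "i \<le> n" "e = {r, p i}" | i j where "i \<le> n" "j \<le> n" "e = {p i, p j}" "i \<noteq> j"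
    using xy by (auto simp: insert_commute)
  then show False
  proof cases
    case 1
    then show False by (rule r_chord)
  next
    case (2 i j)
    then show False using path_chord[of i j] path_chord[of j i]
      by (auto simp: insert_commute neq_iff)
  qed
qed

text \<open>
  Take a maximal connected \<open>A\<close> that does not dominate \<open>R\<close>. By maximality each boundary vertex of \<open>A\<close>
  sees all of the undominated rest, and by chordality the boundary is a clique, so a simplicial
  vertex of the rest is simplicial in \<open>R\<close>.
\<close>

lemma simplicial_vertex:
  assumes G: "simple_graph G" "chordal G" and "R \<subseteq> verts G" and "R \<noteq> {}"
  shows "\<exists>v\<in>R. clique G {x \<in> R. adjacent G v x}"
proof -
  have "finite R" using assms(1,3) by (auto simp: simple_graph_def intro: finite_subset)
  then show ?thesis using assms(3,4)
  proof (induction R rule: finite_psubset_induct)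
    case (psubset R)
    show ?case
    proof (cases "clique G R")
      case True
      then show ?thesis using psubset.prems(2) by (auto simp: clique_def)
    next
      case False
      then obtain a b where ab: "a \<in> R" "b \<in> R" "a \<noteq> b" "\<not> adjacent G a b"
        by (auto simp: clique_def)
      \<comment> \<open>\<open>touching\<close> includes equality, so the last set consists of the
        vertices of \<open>R\<close> outside \<open>A\<close> without a neighbour in
        \<open>A\<close>.\<close>
      define good where "good A \<longleftrightarrow> A \<subseteq> R \<and> graph_connected (induced G A) \<and>
        {x \<in> R. \<not> touching G A {x}} \<noteq> {}" for A
      have "good {a}"
        using ab psubset.prems(1) by (auto simp: good_def touching_def intro: connected_singleton)
      moreover have "\<forall>A. good A \<longrightarrow> card A \<le> card R"
        using psubset.hyps by (auto simp: good_def intro: card_mono)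
      ultimately have "\<exists>A. good A \<and> (\<forall>B. good B \<longrightarrow> card B \<le> card A)"
        using ex_has_greatest_nat[of good "{a}" card "Suc (card R)"] by (auto simp: less_Suc_eq_le)
      then obtain A where A: "good A" and max: "\<And>B. good B \<Longrightarrow> card B \<le> card A" by auto
      define R' where "R' = {x \<in> R. \<not> touching G A {x}}"
      have AR: "A \<subseteq> R" and Ac: "graph_connected (induced G A)" and "R' \<noteq> {}"
        using A by (auto simp: good_def R'_def)
      obtain a' where "a' \<in> A" using connected_nonempty[OF Ac] by auto
      then have "a' \<notin> R'" by (auto simp: R'_def touching_def)
      then have "R' \<subset> R" using \<open>a' \<in> A\<close> AR by (auto simp: R'_def)
      then obtain v where v: "v \<in> R'" "clique G {x \<in> R'. adjacent G v x}"
        using psubset.IH \<open>R' \<noteq> {}\<close> psubset.prems(1) by blast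
      have vA: "v \<notin> A" "\<And>h. h \<in> A \<Longrightarrow> \<not> adjacent G v h"
        using v(1) by (auto simp: R'_def touching_def adjacent_sym[of G v])
      have full: "adjacent G x y" if x: "x \<in> R" "x \<notin> A" "touching G A {x}" and y: "y \<in> R'" for x y
      proof (rule ccontr)
        assume xy: "\<not> adjacent G x y"
        obtain h where h: "h \<in> A" "adjacent G h x" using x by (auto simp: touching_def)
        have "graph_connected (induced G (insert x A))"
          using connected_insert[OF Ac _ h] AR psubset.prems(1) x(1) by auto
        moreover have "\<not> touching G (insert x A) {y}"
          using y x(3) xy by (auto simp: R'_def touching_def)
        ultimately have "good (insert x A)"
          using x(1) AR y by (auto simp: good_def R'_def)
        then show False
          using max[of "insert x A"] x(2) finite_subset[OF AR psubset.hyps] by simp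
      qed
      have "adjacent G x y"
        if x: "x \<in> R" "adjacent G v x" and y: "y \<in> R" "adjacent G v y" and "x \<noteq> y" for x y
      proof -
        have xA: "x \<notin> A" and yA: "y \<notin> A" using x y vA by auto
        \<comment> \<open>No neighbour of \<open>v\<close> is in \<open>A\<close>, so each is in the
          rest or on the boundary. Two in the rest are adjacent by the choice of \<open>v\<close>, a
          mixed pair by maximality, two on the boundary by chordality with \<open>A\<close> as the
          connected set.\<close>
        consider "x \<in> R'" "y \<in> R'" | "x \<notin> R'" "y \<in> R'" | "x \<in> R'" "y \<notin> R'"
          | "x \<notin> R'" "y \<notin> R'" by blast
        then show ?thesis
        proof cases
          case 1
          then show ?thesis using v(2) x y \<open>x \<noteq> y\<close> by (auto simp: clique_def)
        next
          case 2
          then show ?thesis using full[of x y] x xA by (auto simp: R'_def)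
        next
          case 3
          then show ?thesis using full[of y x] y yA adjacent_sym[of G x y] by (auto simp: R'_def)
        next
          case 4
          then have "touching G {x} A" "touching G {y} A"
            using x y touching_sym by (fastforce simp: R'_def)+
          then show ?thesis
            using chordal_adjacent[OF G Ac _ vA x(2) y(2) \<open>x \<noteq> y\<close>] AR psubset.prems(1) by auto
        qed
      qed
      then show ?thesis using v(1) by (intro bexI[of _ v]) (auto simp: clique_def R'_def)
    qed
  qed
qed

text \<open>A walk through \<open>v\<close> enters and leaves by neighbours of \<open>v\<close>,
  which coincide or are adjacent, so \<open>v\<close> can be bypassed.\<close>

lemma connected_delete_simplicial:
  assumes A: "graph_connected (induced G A)" "A \<subseteq> R" "R \<subseteq> verts G" "A \<noteq> {v}"
    and v: "clique G {x \<in> R. adjacent G v x}"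
  shows "graph_connected (induced G (A - {v}))"
proof -
  have AV: "A \<subseteq> verts G" using A by auto
  obtain a where a: "a \<in> A - {v}" using connected_nonempty[OF A(1)] A(4) by auto
  let ?r = "reachable (induced G (A - {v}))"
  show ?thesis
  proof (rule connectedI[OF a])
    show "A - {v} \<subseteq> verts G" using AV by auto
    fix x assume x: "x \<in> A - {v}"
    have "reachable (induced G A) a x" using connectedD[OF A(1) AV] a x by simp
    \<comment> \<open>When the walk stands at \<open>v\<close>, the invariant promises that every
      possible next vertex is already reachable without \<open>v\<close>.\<close>
    then have "(x \<noteq> v \<longrightarrow> ?r a x) \<and> (x = v \<longrightarrow> (\<forall>z\<in>A. adjacent G v z \<longrightarrow> z = v \<or> ?r a z))"
      unfolding reachable_def[of "induced G A"]
    proof (induction rule: rtranclp_induct)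
      case base
      then show ?case using a by (auto intro: reachable_refl)
    next
      case (step y z)
      then have yz: "adjacent G y z" "y \<in> A" "z \<in> A" by (auto simp: adjacent_induced)
      have ext: "?r a z'" if "?r a y'" "y' \<in> A - {v}" "z' \<in> A - {v}" "adjacent G y' z'" for y' z'
        using reachable_trans[OF that(1) reachable_adjacent[of _ y' z']] that
        by (simp add: adjacent_induced)
      consider "y \<noteq> v" "z \<noteq> v" | "y \<noteq> v" "z = v" | "y = v" by blast
      then show ?case
      proof cases
        case 1
        then show ?thesis using ext[of y z] step.IH yz by auto
      next
        case 2
        have "?r a z'" if z': "z' \<in> A" "adjacent G v z'" "z' \<noteq> v" for z'
        proof (cases "z' = y")
          case True
          then show ?thesis using step.IH 2 by auto
        next
          case False
          have "adjacent G y z'"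
            using v False yz z' A(2) 2 adjacent_sym[of G v y] by (auto simp: clique_def)
          then show ?thesis using ext[of y z'] step.IH 2 yz z' by auto
        qed
        then show ?thesis using 2 by auto
      next
        case 3
        then show ?thesis using step.IH yz by auto
      qed
    qed
    then show "?r a x" using x by simp
  qed
qed

text \<open>If the contact uses \<open>v\<close>, move to a neighbour of \<open>v\<close> in the
  same set: a connected set other than \<open>{v}\<close> that contains \<open>v\<close> has one,
  and neighbours of \<open>v\<close> coincide or are adjacent.\<close>

lemma touching_delete_simplicial:
  assumes G: "simple_graph G"
    and A: "graph_connected (induced G A)" "A \<subseteq> R" "A \<noteq> {v}"
    and B: "graph_connected (induced G B)" "B \<subseteq> R" "B \<noteq> {v}"
    and "R \<subseteq> verts G" and v: "clique G {x \<in> R. adjacent G v x}" and AB: "touching G A B"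
  shows "touching G (A - {v}) (B - {v})"
proof -
  have nbr: "\<exists>z\<in>X - {v}. adjacent G v z"
    if X: "graph_connected (induced G X)" "X \<subseteq> R" "X \<noteq> {v}" and "v \<in> X" for X
  proof (rule ccontr)
    assume no: "\<not> ?thesis"
    have "X \<subseteq> {v}"
      by (rule connected_closed[OF X(1) _ _ \<open>v \<in> X\<close>]) (use X no assms(8) in auto)
    then show False using X(3) \<open>v \<in> X\<close> by auto
  qed
  have vclique: "x = y \<or> adjacent G x y"
    if "x \<in> R" "y \<in> R" "adjacent G v x" "adjacent G v y" for x y
    using that v by (auto simp: clique_def)
  obtain a b where ab: "a \<in> A" "b \<in> B" "a = b \<or> adjacent G a b"
    using AB by (auto simp: touching_def)
  have "\<exists>a'\<in>A - {v}. a \<noteq> v \<and> a' = a \<or> a = v \<and> adjacent G v a'"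
    using nbr[OF A] ab(1) by (cases "a = v") auto
  then obtain a' where a': "a' \<in> A - {v}" "a \<noteq> v \<and> a' = a \<or> a = v \<and> adjacent G v a'" by auto
  have "\<exists>b'\<in>B - {v}. b \<noteq> v \<and> b' = b \<or> b = v \<and> adjacent G v b'"
    using nbr[OF B] ab(2) by (cases "b = v") auto
  then obtain b' where b': "b' \<in> B - {v}" "b \<noteq> v \<and> b' = b \<or> b = v \<and> adjacent G v b'" by auto
  have "a' = b' \<or> adjacent G a' b'"
    using ab(3) a' b' vclique[of a' b'] A(2) B(2) adjacent_irrefl[OF G] adjacent_sym[of G a' v]
    by auto
  then show ?thesis using a' b' by (auto simp: touching_def)
qed

text \<open>
  The Helly property of subtrees, phrased without a clique tree: a simplicial vertex can be deleted
  from all members of the family, unless it is itself a member, and then its closed neighbourhood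
  meets every member.
\<close>

lemma clique_meets_touching_family:
  assumes G: "simple_graph G" "chordal G" and "R \<subseteq> verts G"
    and "\<And>A. A \<in> F \<Longrightarrow> A \<subseteq> R \<and> graph_connected (induced G A)"
    and "\<And>A B. A \<in> F \<Longrightarrow> B \<in> F \<Longrightarrow> touching G A B"
  shows "\<exists>K\<subseteq>R. clique G K \<and> (\<forall>A\<in>F. K \<inter> A \<noteq> {})"
proof -
  have "finite R" using assms(1,3) by (auto simp: simple_graph_def intro: finite_subset)
  then show ?thesis using assms(3-5)
  proof (induction R arbitrary: F rule: finite_psubset_induct)
    case (psubset R)
    show ?case
    proof (cases "R = {}")
      case True
      then have "F = {}" using psubset.prems(2) connected_nonempty by fastforce
      then show ?thesis by (auto simp: clique_def)
    next
      case False
      then obtain v where v: "v \<in> R" "clique G {x \<in> R. adjacent G v x}"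
        using simplicial_vertex[OF G psubset.prems(1)] by auto
      show ?thesis
      proof (cases "{v} \<in> F")
        case True
        let ?K = "insert v {x \<in> R. adjacent G v x}"
        have "clique G ?K" using v(2) by (auto simp: clique_def adjacent_sym)
        moreover have "?K \<inter> A \<noteq> {}" if A: "A \<in> F" for A
        proof -
          obtain b where "b \<in> A" "v = b \<or> adjacent G v b"
            using psubset.prems(3)[OF True A] by (auto simp: touching_def)
          then show ?thesis using psubset.prems(2)[OF A] by auto
        qed
        ultimately show ?thesis using v(1) by (intro exI[of _ ?K]) auto
      next
        case False
        then have nv: "A \<noteq> {v}" if "A \<in> F" for A using that by auto
        let ?F = "(\<lambda>A. A - {v}) ` F"
        have "\<exists>K\<subseteq>R - {v}. clique G K \<and> (\<forall>A\<in>?F. K \<inter> A \<noteq> {})"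
        proof (rule psubset.IH)
          show "R - {v} \<subset> R" "R - {v} \<subseteq> verts G" using v(1) psubset.prems(1) by auto
          show "A \<subseteq> R - {v} \<and> graph_connected (induced G A)" if "A \<in> ?F" for A
            using that psubset.prems(2) connected_delete_simplicial[OF _ _ psubset.prems(1) nv v(2)]
            by auto
          show "touching G A B" if "A \<in> ?F" "B \<in> ?F" for A B
            using that psubset.prems(2,3) nv
              touching_delete_simplicial[OF G(1) _ _ _ _ _ _ psubset.prems(1) v(2)]
            by auto
        qed
        then obtain K where K: "K \<subseteq> R - {v}" "clique G K" "\<And>A. A \<in> F \<Longrightarrow> K \<inter> (A - {v}) \<noteq> {}"
          by auto
        show ?thesis
        proof (intro exI[of _ K] conjI ballI)
          show "K \<inter> A \<noteq> {}" if "A \<in> F" for A using K(3)[OF that] by auto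
        qed (use K in auto)
      qed
    qed
  qed
qed

section \<open>Dominating cliques and the diameter\<close>

text \<open>A walk of length at most 3 splits into at most one step at \<open>u\<close>, one in the
  middle and one at \<open>v\<close>.\<close>

lemma graph_dist_le_3_iff:
  assumes "graph_connected G" and "u \<in> verts G" and "v \<in> verts G"
  shows "graph_dist G u v \<le> 3 \<longleftrightarrow> touching G (closed_nbhd G u) (closed_nbhd G v)"
proof -
  let ?R = "adjacent G"
  have "?R\<^sup>*\<^sup>* u v" using assms by (auto simp: graph_connected_def reachable_def)
  \<comment> \<open>Some walk exists, so the \<open>LEAST\<close> in \<open>graph_dist\<close> is
    attained and not an unspecified value.\<close>
  then obtain m where m: "(?R ^^ m) u v" using rtranclp_imp_relpowp by metis
  have "graph_dist G u v \<le> 3 \<longleftrightarrow> (\<exists>n\<le>3. (?R ^^ n) u v)"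
  proof
    assume "graph_dist G u v \<le> 3"
    then show "\<exists>n\<le>3. (?R ^^ n) u v"
      unfolding graph_dist_def using LeastI[of "\<lambda>n. (?R ^^ n) u v", OF m] by auto
  next
    assume "\<exists>n\<le>3. (?R ^^ n) u v"
    then show "graph_dist G u v \<le> 3"
      unfolding graph_dist_def using Least_le[of "\<lambda>n. (?R ^^ n) u v"] le_trans by blast
  qed
  also have "\<dots> \<longleftrightarrow> u = v \<or> ?R u v \<or> (?R OO ?R) u v \<or> (?R OO ?R OO ?R) u v"
  proof -
    have "n \<le> 3 \<longleftrightarrow> n = 0 \<or> n = 1 \<or> n = 2 \<or> n = 3" for n :: nat by auto
    then have "(\<exists>n\<le>3. (?R ^^ n) u v) \<longleftrightarrow>
        (?R ^^ 0) u v \<or> (?R ^^ 1) u v \<or> (?R ^^ 2) u v \<or> (?R ^^ 3) u v"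
      by metis
    moreover have "?R ^^ 0 = (=)" "?R ^^ 1 = ?R" "?R ^^ 2 = ?R OO ?R" "?R ^^ 3 = ?R OO ?R OO ?R"
      by (simp_all add: numeral_2_eq_2 numeral_3_eq_3 relcompp_assoc eq_OO)
    ultimately show ?thesis by simp
  qed
  also have "\<dots> \<longleftrightarrow> touching G (closed_nbhd G u) (closed_nbhd G v)"
    unfolding touching_def closed_nbhd_def using adjacent_sym[of G v]
    by (simp add: relcompp_apply) metis
  finally show ?thesis .
qed

lemma graph_diam_le_3_iff:
  assumes "simple_graph G" and "graph_connected G"
  shows "graph_diam G \<le> 3 \<longleftrightarrow>
    (\<forall>u\<in>verts G. \<forall>v\<in>verts G. touching G (closed_nbhd G u) (closed_nbhd G v))"
proof -
  let ?D = "{graph_dist G u v | u v. u \<in> verts G \<and> v \<in> verts G}"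
  have "?D = (\<lambda>(u, v). graph_dist G u v) ` (verts G \<times> verts G)" by auto
  then have "finite ?D" using assms(1) by (simp add: simple_graph_def)
  moreover have "?D \<noteq> {}" using assms(2) unfolding graph_connected_def by blast
  ultimately have "graph_diam G \<le> 3 \<longleftrightarrow> (\<forall>u\<in>verts G. \<forall>v\<in>verts G. graph_dist G u v \<le> 3)"
    unfolding graph_diam_def by (subst Max_le_iff) auto
  then show ?thesis using graph_dist_le_3_iff[OF assms(2)] by simp
qed

text \<open>Domination as a transversal condition, the form that
  \<open>clique_meets_touching_family\<close> delivers.\<close>

lemma dominating_clique_iff:
  "dominating_clique G K \<longleftrightarrow>
    K \<subseteq> verts G \<and> clique G K \<and> (\<forall>v\<in>verts G. K \<inter> closed_nbhd G v \<noteq> {})"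
  unfolding dominating_clique_def clique_def closed_nbhd_def
  using adjacent_sym[of G] by (auto; blast)

text \<open>From left to right: one step into the clique, one inside it and one out of it
  suffice.\<close>

lemma dominating_clique_iff_diam:
  assumes "simple_graph G" and "graph_connected G" and "chordal G"
  shows "(\<exists>K. dominating_clique G K) \<longleftrightarrow> graph_diam G \<le> 3"
proof
  assume "\<exists>K. dominating_clique G K"
  then obtain K where K: "clique G K" "\<And>v. v \<in> verts G \<Longrightarrow> K \<inter> closed_nbhd G v \<noteq> {}"
    by (auto simp: dominating_clique_iff)
  have "touching G (closed_nbhd G u) (closed_nbhd G v)" if u: "u \<in> verts G" and v: "v \<in> verts G" for u v
  proof -
    obtain x y where "x \<in> K" "x \<in> closed_nbhd G u" "y \<in> K" "y \<in> closed_nbhd G v"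
      using K(2)[OF u] K(2)[OF v] by auto
    then show ?thesis using K(1) unfolding touching_def clique_def by blast
  qed
  then show "graph_diam G \<le> 3" using graph_diam_le_3_iff[OF assms(1,2)] by simp
next
  assume diam: "graph_diam G \<le> 3"
  have "\<exists>K\<subseteq>verts G. clique G K \<and> (\<forall>A\<in>closed_nbhd G ` verts G. K \<inter> A \<noteq> {})"
  proof (rule clique_meets_touching_family[OF assms(1,3)])
    show "A \<subseteq> verts G \<and> graph_connected (induced G A)" if "A \<in> closed_nbhd G ` verts G" for A
      using that closed_nbhd_verts[OF assms(1)] connected_closed_nbhd[OF assms(1)] by auto
    show "touching G A B" if "A \<in> closed_nbhd G ` verts G" "B \<in> closed_nbhd G ` verts G" for A B
      using that diam graph_diam_le_3_iff[OF assms(1,2)] by auto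
  qed simp
  then show "\<exists>K. dominating_clique G K" by (auto simp: dominating_clique_iff)
qed

section \<open>Dominating cliques and safe sets\<close>

text \<open>Every vertex of \<open>T\<close> outside \<open>K\<close> hangs on a vertex of
  \<open>K\<close>, and \<open>K\<close> is connected. Vertices can thus be added without a new
  connectivity argument.\<close>

lemma connected_superset_dominating_clique:
  assumes K: "dominating_clique G K" "K \<noteq> {}" and T: "K \<subseteq> T" "T \<subseteq> verts G"
  shows "graph_connected (induced G T)"
proof -
  have KV: "K \<subseteq> verts G" and Kc: "clique G K"
    and dom: "\<And>v. v \<in> verts G \<Longrightarrow> K \<inter> closed_nbhd G v \<noteq> {}"
    using K(1) by (auto simp: dominating_clique_iff)
  obtain a where a: "a \<in> K" using K(2) by auto
  show ?thesis
  proof (rule connectedI)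
    show "a \<in> T" using a T by auto
    fix x assume x: "x \<in> T"
    then obtain k where k: "k \<in> K" "k \<in> closed_nbhd G x" using dom T(2) by blast
    have "reachable (induced G K) a k"
      by (rule connectedD[OF connected_clique[OF Kc KV K(2)] KV a k(1)])
    then have "reachable (induced G T) a k" by (rule reachable_mono[OF _ T(1)])
    moreover have "reachable (induced G T) k x"
      using k x T adjacent_sym[of G x k]
      by (cases "k = x") (auto simp: closed_nbhd_def adjacent_induced subset_iff
          intro!: reachable_refl reachable_adjacent)
    ultimately show "reachable (induced G T) a x" by (rule reachable_trans)
  qed (rule T)
qed

text \<open>
  Let \<open>C\<close> be a component of the disconnected safe set \<open>S\<close> missing the clique \<open>K\<close>, and \<open>D\<close> the component
  of the complement meeting \<open>K\<close>. Exchanging \<open>C\<close> for \<open>D\<close> does not increase the weight, and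
  every superset of the result is connected. By chordality \<open>C\<close> is then a component of
  the complement, and the only possible obstruction to safety is that \<open>C\<close> is too heavy. In that case
  either \<open>C\<close> itself is safe or vertices outside \<open>C\<close> are added until \<open>C\<close> is balanced; no
  such vertex is heavier than \<open>S - C\<close>, so the total stays below the weight of \<open>S\<close>.
\<close>

lemma dominating_clique_connected_safe_set:
  assumes G: "simple_graph G" "graph_connected G" "chordal G"
    and K: "dominating_clique G K" and w: "weight_function G w"
    and S: "weighted_safe_set G w S"
  shows "\<exists>T. connected_weighted_safe_set G w T \<and> sum w T \<le> sum w S"
proof (cases "graph_connected (induced G S)")
  case True
  then show ?thesis using S by (auto simp: connected_weighted_safe_set_def)
next
  case False
  let ?V = "verts G"
  note sum_mono = sum_weight_mono[OF G(1) w]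
  have fin: "finite X" if "X \<subseteq> ?V" for X
    using G(1) that by (auto simp: simple_graph_def intro: finite_subset)
  have SV: "S \<subseteq> ?V" and "S \<noteq> {}"
    and safe: "\<And>x y. x \<in> S \<Longrightarrow> y \<in> ?V - S \<Longrightarrow> adjacent G x y \<Longrightarrow>
       sum w (component_of G (?V - S) y) \<le> sum w (component_of G S x)"
    using S by (auto simp: weighted_safe_set_iff[OF G(1)])
  have KV: "K \<subseteq> ?V" and Kc: "\<And>x y. x \<in> K \<Longrightarrow> y \<in> K \<Longrightarrow> x \<noteq> y \<Longrightarrow> adjacent G x y"
    and dom: "\<And>v. v \<in> ?V \<Longrightarrow> v \<notin> K \<Longrightarrow> \<exists>k\<in>K. adjacent G k v"
    using K by (auto simp: dominating_clique_def)
  \<comment> \<open>A clique cannot meet two components of \<open>S\<close>, so one of them misses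
    \<open>K\<close>.\<close>
  obtain c0 where c0: "c0 \<in> S" "component_of G S c0 \<inter> K = {}"
  proof -
    obtain x where x: "x \<in> S" using \<open>S \<noteq> {}\<close> by auto
    obtain y where y: "y \<in> S" "\<not> reachable (induced G S) x y"
      using False connectedI[OF x SV] by auto
    have "component_of G S x \<inter> K = {} \<or> component_of G S y \<inter> K = {}"
    proof (rule ccontr)
      assume "\<not> ?thesis"
      then obtain a b where ab: "a \<in> component_of G S x" "a \<in> K" "b \<in> component_of G S y" "b \<in> K"
        by auto
      have "b \<in> component_of G S x"
        using ab component_of_closed[OF ab(1)] Kc[of a b] component_of_subset(1)[of G S y] KV
        by (cases "a = b") auto
      then have "component_of G S x = component_of G S y"
        using component_of_eq[of b] ab(3) by metis
      then have "y \<in> component_of G S x" using component_of_mem[of y G S] y SV by auto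
      then show False using y(2) by (simp add: component_of_def)
    qed
    then show thesis using that x y(1) by auto
  qed
  define C where "C = component_of G S c0"
  have CS: "C \<subseteq> S" and CV: "C \<subseteq> ?V" and CK: "C \<inter> K = {}" and c0C: "c0 \<in> C"
    using c0 SV component_of_subset[of G S c0] component_of_mem[of c0 G S] by (auto simp: C_def)
  have Ccl: "y \<in> C" if "x \<in> C" "y \<in> S" "adjacent G x y" for x y
    using component_of_closed[of x G S c0 y] that SV by (auto simp: C_def)
  have Cconn: "graph_connected (induced G C)"
    unfolding C_def using SV c0(1) by (rule connected_component_of)
  \<comment> \<open>A dominating neighbour inside \<open>S\<close> would belong to \<open>C\<close>,
    which misses \<open>K\<close>.\<close>
  have C_dom: "\<exists>k\<in>K - S. adjacent G k c" if c: "c \<in> C" for c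
  proof -
    obtain k where k: "k \<in> K" "adjacent G k c" using dom[of c] c CV CK by auto
    then have "k \<notin> S" using Ccl[of c k] c CK adjacent_sym[of G c k] by auto
    then show ?thesis using k by auto
  qed
  obtain k2 where k2: "k2 \<in> K - S" "adjacent G k2 c0" using C_dom[OF c0C] by auto
  define D where "D = component_of G (?V - S) k2"
  have DV: "D \<subseteq> ?V - S" and k2D: "k2 \<in> D"
    using component_of_subset[of G "?V - S" k2] component_of_mem[of k2 G "?V - S"] k2 KV
    by (auto simp: D_def)
  have Dcl: "y \<in> D" if "x \<in> D" "y \<in> ?V - S" "adjacent G x y" for x y
    using component_of_closed[of x G "?V - S" k2 y] that by (auto simp: D_def)
  \<comment> \<open>The vertices of \<open>K\<close> outside \<open>S\<close> form a clique and so
    share one component of the complement.\<close>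
  have KD: "k \<in> D" if "k \<in> K" "k \<notin> S" for k
    using that Dcl[OF k2D, of k] k2D KV Kc[of k2 k] k2 by (cases "k = k2") auto
  have wD: "sum w D \<le> sum w C"
    unfolding C_def D_def using safe[of c0 k2] k2 KV c0(1) adjacent_sym[of G k2 c0] by auto
  define Z where "Z = ?V - S - D"
  \<comment> \<open>All of \<open>K - S\<close> is in \<open>D\<close>, so \<open>z\<close> is
    dominated from within \<open>S\<close>, by a component other than \<open>C\<close>. Safety there
    bounds the weight of the component of \<open>z\<close> by that of \<open>S - C\<close>.\<close>
  have Z_dom: "\<exists>k\<in>K \<inter> S. k \<notin> C \<and> adjacent G k z" if z: "z \<in> Z" for z
  proof -
    have "z \<notin> K" using KD z by (auto simp: Z_def)
    then obtain k where k: "k \<in> K" "adjacent G k z" using dom[of z] z by (auto simp: Z_def)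
    have "k \<in> S" using KD[OF k(1)] Dcl[of k z] k z by (auto simp: Z_def)
    then show ?thesis using k CK by auto
  qed
  have wZ: "sum w (component_of G (?V - S) z) \<le> sum w (S - C)" if z: "z \<in> Z" for z
  proof -
    obtain k where k: "k \<in> K" "k \<in> S" "k \<notin> C" "adjacent G k z" using Z_dom[OF z] by auto
    have "component_of G S k \<inter> C = {}"
    proof (rule ccontr)
      assume "\<not> ?thesis"
      then obtain x where x: "x \<in> component_of G S k" "x \<in> C" by auto
      then have "component_of G S k = C" using component_of_eq[of x] unfolding C_def by metis
      then show False using k SV component_of_mem[of k G S] by auto
    qed
    then have "sum w (component_of G S k) \<le> sum w (S - C)"
      using component_of_subset(1)[of G S k] SV by (intro sum_mono) auto
    moreover have "sum w (component_of G (?V - S) z) \<le> sum w (component_of G S k)"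
      using safe[of k z] k z by (auto simp: Z_def)
    ultimately show ?thesis by simp
  qed
  have CZ: "\<not> adjacent G c z" if c: "c \<in> C" and z: "z \<in> Z" for c z
  proof
    assume cz: "adjacent G c z"
    obtain k1 where k1: "k1 \<in> K" "k1 \<in> S" "k1 \<notin> C" "adjacent G k1 z" using Z_dom[OF z] by auto
    obtain k where k: "k \<in> K" "k \<notin> S" "adjacent G k c" using C_dom[OF c] by auto
    have kz: "k \<noteq> z" "\<not> adjacent G k z"
      using KD[OF k(1,2)] Dcl[of k z] z by (auto simp: Z_def)
    \<comment> \<open>The 4-cycle \<open>k\<close>, \<open>c\<close>, \<open>z\<close>,
      \<open>k1\<close> lacks the diagonal from \<open>k\<close> to \<open>z\<close>, so it has the
      other one, which would put \<open>k1\<close> into \<open>C\<close>.\<close>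
    have "adjacent G c k1"
      by (rule chordal_adjacent[OF G(1,3), of "{z}" k c k1])
        (use kz z k k1 c cz Kc[of k k1] in \<open>auto simp: Z_def touching_def intro: connected_singleton\<close>)
    then show False using Ccl[OF c k1(2)] k1(3) by auto
  qed
  show ?thesis
  proof (cases "sum w (?V - C) \<le> sum w C")
    case True
    have "sum w (component_of G (?V - C) y) \<le> sum w C" for y
      using sum_mono[OF component_of_subset(1)[of G "?V - C" y]] True by auto
    then have "connected_weighted_safe_set G w C"
      using CV Cconn by (simp add: connected_weighted_safe_set_iff[OF G(1,2)])
    moreover have "sum w C \<le> sum w S" using CS SV by (rule sum_mono)
    ultimately show ?thesis by auto
  next
    case False
    define T0 where "T0 = (S - C) \<union> D"
    have T0: "T0 \<subseteq> ?V - C" "K \<subseteq> T0" using SV DV CS CK KD by (auto simp: T0_def)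
    define good where "good T \<longleftrightarrow> T0 \<subseteq> T \<and> T \<subseteq> ?V - C \<and> sum w C \<le> sum w T" for T
    have "good (?V - C)" using T0 False by (auto simp: good_def)
    then obtain T where T: "good T" and least: "\<And>T'. good T' \<Longrightarrow> card T \<le> card T'"
      using ex_has_least_nat[of good _ card] by metis
    have TV: "T \<subseteq> ?V" and TC: "T \<inter> C = {}" and T0T: "T0 \<subseteq> T" and wT: "sum w C \<le> sum w T"
      using T by (auto simp: good_def)
    have rest: "x \<in> C \<or> x \<in> Z" if "x \<in> ?V" "x \<notin> T0" for x
      using that by (auto simp: T0_def Z_def)
    have wSC: "sum w (S - C) + sum w C = sum w S"
      using CS fin[OF SV] by (simp add: sum.subset_diff[of C S] add.commute)
    have "sum w T \<le> sum w S"
    proof (cases "T = T0")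
      case True
      have "sum w T0 = sum w (S - C) + sum w D"
        unfolding T0_def using SV DV by (intro sum.union_disjoint fin) auto
      then show ?thesis using True wD wSC by simp
    next
      case False
      then obtain x where x: "x \<in> T" "x \<notin> T0" using T0T by auto
      then have xZ: "x \<in> Z" using rest TV TC by auto
      \<comment> \<open>Removing \<open>x\<close> keeps \<open>T0\<close>, so by minimality it
        destroys the balance; hence \<open>T\<close> weighs less than \<open>C\<close> plus
        \<open>x\<close>, and \<open>x\<close> at most as much as \<open>S - C\<close>.\<close>
      have "\<not> good (T - {x})"
        using least[of "T - {x}"] x fin[OF TV] card_Diff1_less[of T x] by auto
      then have "sum w (T - {x}) < sum w C" using T x by (auto simp: good_def)
      moreover have "sum w T = w x + sum w (T - {x})" using x fin[OF TV] by (simp add: sum.remove)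
      moreover have "w x \<le> sum w (component_of G (?V - S) x)"
        using sum_mono[of "{x}" "component_of G (?V - S) x"] component_of_subset(2)[of G "?V - S" x]
          component_of_mem[of x G "?V - S"] xZ by (auto simp: Z_def)
      ultimately show ?thesis using wZ[OF xZ] wSC by simp
    qed
    moreover have "sum w (component_of G (?V - T) y) \<le> sum w T" if y: "y \<in> ?V - T" for y
    proof (cases "y \<in> C")
      case True
      have "component_of G (?V - T) y \<subseteq> C"
      proof (rule component_of_subset_closed[OF True])
        fix a b assume "a \<in> C" "b \<in> ?V - T" "adjacent G a b"
        then show "b \<in> C" using CZ[of a b] rest[of b] T0T by auto
      qed
      then have "sum w (component_of G (?V - T) y) \<le> sum w C" using CV by (rule sum_mono)
      then show ?thesis using wT by simp
    next
      case False
      then have yZ: "y \<in> Z" using rest y T0T by auto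
      let ?E = "component_of G (?V - S) y"
      have EZ: "?E \<subseteq> Z"
      proof (rule component_of_subset_closed[OF yZ])
        fix a b assume "a \<in> Z" "b \<in> ?V - S" "adjacent G a b"
        then show "b \<in> Z" using Dcl[of b a] adjacent_sym[of G a b] by (auto simp: Z_def)
      qed
      \<comment> \<open>Outside \<open>T\<close> only parts of \<open>C\<close> and \<open>Z\<close>
        remain, with no edge between them, so the component of \<open>y\<close> stays within its old
        component.\<close>
      have "component_of G (?V - T) y \<subseteq> ?E"
      proof (rule component_of_subset_closed)
        show "y \<in> ?E" using yZ by (auto simp: Z_def intro: component_of_mem)
        fix a b assume ab: "a \<in> ?E" "b \<in> ?V - T" "adjacent G a b"
        then have "b \<notin> C" using CZ[of b a] EZ adjacent_sym[of G a b] by auto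
        then have "b \<in> ?V - S" using rest[of b] ab T0T by (auto simp: Z_def)
        then show "b \<in> ?E" using component_of_closed[OF ab(1)] ab by auto
      qed
      then have "sum w (component_of G (?V - T) y) \<le> sum w ?E"
        using component_of_subset(2) by (rule sum_mono)
      also have "\<dots> \<le> sum w (S - C)" using yZ by (rule wZ)
      also have "\<dots> \<le> sum w T" using T0T TV by (intro sum_mono) (auto simp: T0_def)
      finally show ?thesis .
    qed
    moreover have "graph_connected (induced G T)"
      using connected_superset_dominating_clique[OF K _ _ TV] T0 T0T k2 by auto
    ultimately show ?thesis
      using TV by (auto simp: connected_weighted_safe_set_iff[OF G(1,2)])
  qed
qed

section \<open>Diameter at least four\<close>

text \<open>\<open>X\<close> is the complement of the component \<open>H\<close> of \<open>v\<close>
  left after removing the closed neighbourhood of \<open>u\<close>, and \<open>P\<close> is its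
  boundary towards \<open>H\<close>. Edges leaving \<open>H\<close> end at neighbours of
  \<open>u\<close>, and \<open>u\<close> sees all of \<open>P\<close> but nothing of
  \<open>H\<close>, so chordality makes \<open>P\<close> a clique. The last conclusion, maximality
  of \<open>H\<close>, later separates the sides built from the two ends.\<close>

lemma separating_clique:
  assumes G: "simple_graph G" "graph_connected G" "chordal G"
    and u: "u \<in> verts G" and v: "v \<in> verts G"
    and far: "\<not> touching G (closed_nbhd G u) (closed_nbhd G v)"
  obtains X P where "X \<subseteq> verts G" "P \<subseteq> X" "u \<in> X - P" "v \<notin> X" "P \<noteq> {}" "clique G P"
    "\<And>x. x \<in> P \<Longrightarrow> adjacent G u x"
    "\<And>x y. x \<in> X \<Longrightarrow> y \<in> verts G - X \<Longrightarrow> adjacent G x y \<Longrightarrow> x \<in> P"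
    "\<And>x. x \<in> P \<Longrightarrow> \<exists>y\<in>verts G - X. adjacent G x y"
    "graph_connected (induced G X)" "X \<inter> closed_nbhd G v = {}"
    "\<And>Z. graph_connected (induced G Z) \<Longrightarrow> Z \<subseteq> verts G \<Longrightarrow> v \<in> Z \<Longrightarrow>
       Z \<inter> closed_nbhd G u = {} \<Longrightarrow> Z \<inter> X = {}"
proof -
  let ?V = "verts G" and ?N = "closed_nbhd G u"
  have Gc: "graph_connected (induced G ?V)" using G by (simp add: induced_verts)
  define H where "H = component_of G (?V - ?N) v"
  define X where "X = ?V - H"
  define P where "P = {x \<in> X. \<exists>h\<in>H. adjacent G x h}"
  have uv: "v \<notin> ?N" using far by (auto simp: touching_def closed_nbhd_def)
  have HV: "H \<subseteq> ?V - ?N" and vH: "v \<in> H"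
    using component_of_subset[of G "?V - ?N" v] component_of_mem[of v G "?V - ?N"] v uv
    by (auto simp: H_def)
  have Hc: "graph_connected (induced G H)"
    unfolding H_def using v uv by (intro connected_component_of) auto
  have Hcl: "y \<in> H" if "x \<in> H" "y \<in> ?V - ?N" "adjacent G x y" for x y
    using component_of_closed[of x G "?V - ?N" v y] that by (auto simp: H_def)
  have NvH: "closed_nbhd G v \<subseteq> H"
  proof
    fix x assume x: "x \<in> closed_nbhd G v"
    then have "x \<notin> ?N" using far unfolding touching_def by blast
    moreover have "x \<in> ?V" using x closed_nbhd_verts[OF G(1) v] by auto
    ultimately show "x \<in> H" using x Hcl[OF vH, of x] vH by (auto simp: closed_nbhd_def)
  qed
  have uH: "u \<notin> H" "\<And>h. h \<in> H \<Longrightarrow> \<not> adjacent G u h" using HV by (auto simp: closed_nbhd_def)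
  have Pu: "adjacent G u x" if x: "x \<in> P" for x
  proof -
    obtain h where h: "h \<in> H" "adjacent G x h" using x by (auto simp: P_def)
    then have "x \<in> ?N"
      using Hcl[of h x] x adjacent_sym[of G x h] by (auto simp: P_def X_def)
    then show ?thesis using h uH by (auto simp: closed_nbhd_def)
  qed
  have uX: "u \<in> X" using u uH by (simp add: X_def)
  show thesis
  proof (rule that[of X P])
    show "X \<subseteq> ?V" "P \<subseteq> X" "v \<notin> X" "X \<inter> closed_nbhd G v = {}"
      using vH NvH by (auto simp: X_def P_def)
    show "u \<in> X - P" using uX Pu[of u] adjacent_irrefl[OF G(1)] by auto
    show "adjacent G u x" if "x \<in> P" for x using that by (rule Pu)
    show "x \<in> P" if "x \<in> X" "y \<in> ?V - X" "adjacent G x y" for x y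
      using that by (auto simp: P_def X_def)
    show "\<exists>y\<in>?V - X. adjacent G x y" if "x \<in> P" for x
      using that HV by (auto simp: P_def X_def)
    show "P \<noteq> {}"
    proof
      assume "P = {}"
      then have "?V \<subseteq> X"
        using uX by (intro connected_closed[OF Gc _ uX]) (auto simp: P_def X_def)
      then show False using vH HV by (auto simp: X_def)
    qed
    show "clique G P"
      unfolding clique_def
    proof (intro ballI impI)
      fix x y assume x: "x \<in> P" and y: "y \<in> P" and "x \<noteq> y"
      have "touching G {x} H" "touching G {y} H" using x y by (auto simp: P_def touching_def)
      then show "adjacent G x y"
        using chordal_adjacent[OF G(1,3) Hc _ uH Pu[OF x] Pu[OF y] \<open>x \<noteq> y\<close>] HV by auto
    qed
    show "graph_connected (induced G X)"
    proof (rule connectedI[OF uX])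
      show XV: "X \<subseteq> ?V" by (auto simp: X_def)
      fix x assume x: "x \<in> X"
      let ?C = "component_of G X x"
      have xC: "x \<in> ?C" using x XV by (auto intro: component_of_mem)
      \<comment> \<open>Leaving \<open>X\<close> is possible only through \<open>P\<close>, whose
        vertices see \<open>u\<close>; a component of \<open>X\<close> without \<open>u\<close>
        would be closed in all of \<open>G\<close>.\<close>
      have "u \<in> ?C"
      proof (rule ccontr)
        assume uC: "u \<notin> ?C"
        have "?V \<subseteq> ?C"
        proof (rule connected_closed[OF Gc _ xC])
          fix a b assume ab: "a \<in> ?C" "b \<in> ?V" "adjacent G a b"
          show "b \<in> ?C"
          proof (cases "b \<in> X")
            case True
            then show ?thesis using component_of_closed[OF ab(1)] ab by auto
          next
            case False
            then have "a \<in> P" using ab component_of_subset(1)[of G X x] by (auto simp: P_def X_def)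
            then have "u \<in> ?C"
              using component_of_closed[OF ab(1) uX u] Pu[of a] adjacent_sym[of G a u] by auto
            then show ?thesis using uC by simp
          qed
        qed (use x XV in auto)
        then show False using uC u by auto
      qed
      then show "reachable (induced G X) u x"
        using reachable_sym[of _ x u] by (simp add: component_of_def)
    qed
    show "Z \<inter> X = {}"
      if "graph_connected (induced G Z)" "Z \<subseteq> ?V" "v \<in> Z" "Z \<inter> ?N = {}" for Z
      using component_of_maximal[OF that(1-3), of "?V - ?N"] that by (auto simp: H_def X_def)
  qed
qed

text \<open>
  Heavy weights sit on \<open>u\<close>, \<open>v\<close> and on one vertex of each of two separating cliques \<open>P\<close>, \<open>Q\<close>
  contained in their neighbourhoods, so that \<open>P \<union> Q\<close> is safe. The vertices of the middle part \<open>M\<close>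
  are light, but heavier than all remaining vertices together. A connected set avoiding \<open>M\<close>
  stays on one side and is outweighed by the other side plus a vertex of \<open>M\<close>; a connected set
  using \<open>M\<close> is either too expensive or leaves two adjacent heavy vertices in the complement.
\<close>

lemma far_vertices_unsafe_weight:
  assumes G: "simple_graph G" "graph_connected G" "chordal G"
    and u: "u \<in> verts G" and v: "v \<in> verts G"
    and far: "\<not> touching G (closed_nbhd G u) (closed_nbhd G v)"
  shows "\<exists>w. weight_function G w \<and> safe_number G w \<noteq> connected_safe_number G w"
proof -
  let ?V = "verts G"
  have far': "\<not> touching G (closed_nbhd G v) (closed_nbhd G u)" using far touching_sym by metis
  obtain X P where XV: "X \<subseteq> ?V" and PX: "P \<subseteq> X" and uX: "u \<in> X - P" and vX: "v \<notin> X"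
    and Pne: "P \<noteq> {}" and Pc: "clique G P" and Pu: "\<And>x. x \<in> P \<Longrightarrow> adjacent G u x"
    and Xout: "\<And>x y. x \<in> X \<Longrightarrow> y \<in> ?V - X \<Longrightarrow> adjacent G x y \<Longrightarrow> x \<in> P"
    and Pout: "\<And>x. x \<in> P \<Longrightarrow> \<exists>y\<in>?V - X. adjacent G x y"
    and Xc: "graph_connected (induced G X)" and Xv: "X \<inter> closed_nbhd G v = {}"
    by (rule separating_clique[OF G u v far]) blast
  obtain Y Q where YV: "Y \<subseteq> ?V" and QY: "Q \<subseteq> Y" and vY: "v \<in> Y - Q" and uY: "u \<notin> Y"
    and Qne: "Q \<noteq> {}" and Qc: "clique G Q" and Qv: "\<And>x. x \<in> Q \<Longrightarrow> adjacent G v x"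
    and Yout: "\<And>x y. x \<in> Y \<Longrightarrow> y \<in> ?V - Y \<Longrightarrow> adjacent G x y \<Longrightarrow> x \<in> Q"
    and Qout: "\<And>x. x \<in> Q \<Longrightarrow> \<exists>y\<in>?V - Y. adjacent G x y"
    and Ymax: "\<And>Z. graph_connected (induced G Z) \<Longrightarrow> Z \<subseteq> ?V \<Longrightarrow> u \<in> Z \<Longrightarrow>
       Z \<inter> closed_nbhd G v = {} \<Longrightarrow> Z \<inter> Y = {}"
    by (rule separating_clique[OF G v u far']) blast
  \<comment> \<open>\<open>X\<close> is connected, contains \<open>u\<close> and avoids the closed
    neighbourhood of \<open>v\<close>, so the maximality obtained with the roles exchanged
    applies.\<close>
  have XY: "X \<inter> Y = {}" using Ymax[OF Xc XV _ Xv] uX by auto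
  have PQ: "\<not> adjacent G x y" if "x \<in> P" "y \<in> Q" for x y
    using far Pu[OF that(1)] Qv[OF that(2)] by (auto simp: touching_def closed_nbhd_def)
  have noXY: "\<not> adjacent G x y" if xy: "x \<in> X" "y \<in> Y" for x y
  proof
    assume a: "adjacent G x y"
    have "x \<in> P" using Xout[of x y] xy a XY YV by auto
    moreover have "y \<in> Q" using Yout[of y x] xy a XY XV adjacent_sym[of G x y] by auto
    ultimately show False using PQ a by auto
  qed
  define M where "M = ?V - X - Y"
  obtain p where p: "p \<in> P" using Pne by auto
  obtain r where r: "r \<in> Q" using Qne by auto
  \<comment> \<open>The neighbour of \<open>p\<close> beyond \<open>X\<close> cannot be in
    \<open>Y\<close>, so the middle part is nonempty.\<close>
  obtain mp where mp: "mp \<in> M" "adjacent G p mp"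
    using Pout[OF p] noXY[of p] p PX by (auto simp: M_def)
  obtain mr where mr: "mr \<in> M" "adjacent G r mr"
    using Qout[OF r] noXY[of _ r] r QY adjacent_sym[of G r] by (auto simp: M_def)
  define B where "B = {u, p, r, v}"
  have distinct: "u \<noteq> p" "u \<noteq> r" "u \<noteq> v" "p \<noteq> r" "p \<noteq> v" "r \<noteq> v"
    using uX p r vY PX QY XY by auto
  have BV: "B \<subseteq> ?V" using u v p r PX XV QY YV by (auto simp: B_def)
  have BM: "B \<inter> M = {}" using uX vY p r PX QY by (auto simp: B_def M_def)
  have BX: "X \<inter> B = {u, p}" and BY: "Y \<inter> B = {r, v}"
    using uX vY p r PX QY XY by (auto simp: B_def)
  \<comment> \<open>All vertices outside \<open>B\<close> weigh at most \<open>1 / 4\<close>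
    together, those outside \<open>B\<close> and \<open>M\<close> at most \<open>\<tau>\<close>. The
    bonus \<open>\<tau>\<close> on \<open>p\<close> and \<open>r\<close> lets each clique match its
    side. Then \<open>S\<close> costs at most \<open>2 + 3 * \<tau>\<close>, while two heavy
    vertices and one of \<open>M\<close> cost at least
    \<open>2 + \<epsilon> = 2 + 4 * \<tau>\<close>.\<close>
  define \<epsilon> :: real where "\<epsilon> = 1 / (4 * card ?V)"
  define \<tau> where "\<tau> = \<epsilon> / 4"
  define \<eta> where "\<eta> = \<tau> / card ?V"
  define w where "w x = (if x = p \<or> x = r then 1 + \<tau> else if x = u \<or> x = v then 1
    else if x \<in> M then \<epsilon> else \<eta>)" for x
  have fin: "finite Z" if "Z \<subseteq> ?V" for Z
    using G(1) that by (auto simp: simple_graph_def intro: finite_subset)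
  have card: "1 \<le> card ?V" using u fin[OF subset_refl] by (auto simp: Suc_le_eq card_gt_0_iff)
  have \<epsilon>: "0 < \<epsilon>" "\<epsilon> \<le> 1 / 4" "card ?V * \<epsilon> = 1 / 4"
    using card by (auto simp: \<epsilon>_def field_simps)
  have \<tau>: "0 < \<tau>" "\<epsilon> = 4 * \<tau>" using \<epsilon> by (auto simp: \<tau>_def)
  have \<eta>: "0 < \<eta>" "\<eta> \<le> \<epsilon>" "card ?V * \<eta> = \<tau>"
    using card \<tau> by (auto simp: \<eta>_def field_simps)
  have wpos: "weight_function G w" using \<epsilon> \<tau> \<eta> by (auto simp: weight_function_def w_def)
  note sum_mono = sum_weight_mono[OF G(1) wpos]
  have wB: "w u = 1" "w v = 1" "w p = 1 + \<tau>" "w r = 1 + \<tau>" using distinct by (auto simp: w_def)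
  have wM: "w m = \<epsilon>" if "m \<in> M" for m using that BM by (auto simp: w_def B_def)
  have wB1: "1 \<le> w b" if "b \<in> B" for b using that wB \<tau> by (auto simp: B_def)
  have wB2: "w b \<le> 1 + \<tau>" if "b \<in> B" for b using that wB \<tau> by (auto simp: B_def)
  have light: "sum w Z \<le> card ?V * c" if "Z \<subseteq> ?V" "0 \<le> c" "\<And>z. z \<in> Z \<Longrightarrow> w z \<le> c" for Z and c :: real
  proof -
    have "sum w Z \<le> card Z * c" using that(3) by (rule sum_bounded_above)
    also have "\<dots> \<le> card ?V * c"
      using that(1,2) fin[OF subset_refl] by (intro mult_right_mono) (auto intro: card_mono)
    finally show ?thesis .
  qed
  have split: "sum w Z \<le> sum w F + sum w (Z - B)" if "Z \<subseteq> ?V" "Z \<inter> B \<subseteq> F" "F \<subseteq> B" for Z F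
  proof -
    have "sum w Z = sum w (Z \<inter> B) + sum w (Z - B)"
      using fin[OF that(1)] by (rule sum.Int_Diff)
    moreover have "sum w (Z \<inter> B) \<le> sum w F" using that BV by (intro sum_mono) auto
    ultimately show ?thesis by simp
  qed
  have bound: "sum w Z \<le> sum w F + 1 / 4" if "Z \<subseteq> ?V" "Z \<inter> B \<subseteq> F" "F \<subseteq> B" for Z F
  proof -
    have "sum w (Z - B) \<le> card ?V * \<epsilon>"
      using that \<epsilon> \<eta> by (intro light) (auto simp: w_def B_def)
    then show ?thesis using split[OF that] \<epsilon>(3) by simp
  qed
  have bound_M: "sum w Z \<le> sum w F + \<tau>"
    if "Z \<subseteq> ?V" "Z \<inter> B \<subseteq> F" "F \<subseteq> B" "Z \<inter> M = {}" for Z F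
  proof -
    have "sum w (Z - B) \<le> card ?V * \<eta>"
      using that \<eta> by (intro light) (auto simp: w_def B_def)
    then show ?thesis using split[OF that(1-3)] \<eta>(3) by simp
  qed
  define S where "S = P \<union> Q"
  have SV: "S \<subseteq> ?V" using PX XV QY YV by (auto simp: S_def)
  have "weighted_safe_set G w S"
    unfolding weighted_safe_set_iff[OF G(1)]
  proof (intro conjI ballI impI)
    show "S \<noteq> {}" "S \<subseteq> ?V" using Pne SV by (auto simp: S_def)
    fix x y assume x: "x \<in> S" and y: "y \<in> ?V - S"
    \<comment> \<open>A lower bound suffices: the component of \<open>x\<close> contains
      \<open>P\<close> or \<open>Q\<close>, hence \<open>p\<close> or \<open>r\<close>.\<close>
    have clq: "sum w L \<le> sum w (component_of G S x)" if "clique G L" "L \<subseteq> S" "x \<in> L" for L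
      using that SV component_of_subset(2)[of G S x]
      by (intro sum_mono component_of_maximal connected_clique) auto
    have "1 + \<tau> \<le> sum w P" "1 + \<tau> \<le> sum w Q"
      using sum_mono[of "{p}" P] sum_mono[of "{r}" Q] p r wB PX XV QY YV by auto
    then have "1 + \<tau> \<le> sum w (component_of G S x)"
      using x clq[OF Pc] clq[OF Qc] by (fastforce simp: S_def)
    moreover have "sum w (component_of G (?V - S) y) \<le> 1 + \<tau>"
    proof -
      have upper: "sum w (component_of G (?V - S) y) \<le> sum w Z"
        if "y \<in> Z" "Z \<subseteq> ?V" "\<And>a b. a \<in> Z \<Longrightarrow> b \<in> ?V - S \<Longrightarrow> adjacent G a b \<Longrightarrow> b \<in> Z" for Z
        by (rule sum_mono[OF component_of_subset_closed[OF that(1)] that(2)]) (rule that(3))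
      \<comment> \<open>An edge leaving \<open>X\<close> starts in \<open>P\<close> and one leaving
        \<open>Y\<close> in \<open>Q\<close>, so these regions are not joined to each other once
        \<open>S\<close> is removed.\<close>
      consider "y \<in> X - P" | "y \<in> Y - Q" | "y \<in> M" using y by (auto simp: S_def M_def)
      then show ?thesis
      proof cases
        case 1
        have "sum w (X - P) \<le> sum w {u} + \<tau>"
          using XV BX p by (intro bound_M) (auto simp: B_def M_def)
        moreover have "sum w (component_of G (?V - S) y) \<le> sum w (X - P)"
          using 1 XV Xout by (intro upper) (auto simp: S_def)
        ultimately show ?thesis using wB by simp
      next
        case 2
        have "sum w (Y - Q) \<le> sum w {v} + \<tau>"
          using YV BY r by (intro bound_M) (auto simp: B_def M_def)
        moreover have "sum w (component_of G (?V - S) y) \<le> sum w (Y - Q)"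
          using 2 YV Yout by (intro upper) (auto simp: S_def)
        ultimately show ?thesis using wB by simp
      next
        case 3
        have "sum w M \<le> sum w {} + 1 / 4"
          using BM by (intro bound) (auto simp: M_def)
        moreover have "sum w (component_of G (?V - S) y) \<le> sum w M"
        proof (rule upper[OF 3])
          show "M \<subseteq> ?V" by (auto simp: M_def)
          fix a b assume "a \<in> M" "b \<in> ?V - S" "adjacent G a b"
          then show "b \<in> M"
            using Xout[of b a] Yout[of b a] adjacent_sym[of G a b] by (auto simp: M_def S_def)
        qed
        ultimately show ?thesis using \<tau> by simp
      qed
    qed
    ultimately show "sum w (component_of G (?V - S) y) \<le> sum w (component_of G S x)" by simp
  qed
  moreover have wS: "sum w S \<le> 2 + 3 * \<tau>"
  proof -
    have "sum w S \<le> sum w {p, r} + \<tau>"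
      using SV uX vY PX QY XY by (intro bound_M) (auto simp: B_def M_def S_def)
    then show ?thesis using wB distinct by simp
  qed
  moreover have "2 + 3 * \<tau> < sum w T" if T: "connected_weighted_safe_set G w T" for T
  proof -
    have TV: "T \<subseteq> ?V" and Tc: "graph_connected (induced G T)"
      using T by (auto simp: connected_weighted_safe_set_iff[OF G(1,2)])
    note T_bound = connected_safe_set_bound[OF G(1,2) wpos T]
    have triple: "sum w {a, b, m} \<le> sum w Z"
      if "a \<in> Z" "b \<in> Z" "m \<in> Z" "Z \<subseteq> ?V" for a b m Z
      using that by (intro sum_mono) auto
    have up: "graph_connected (induced G {u, p})"
      using Pu[OF p] adjacent_sym[of G u p] BV
      by (intro connected_clique) (auto simp: clique_def B_def)
    have vr: "graph_connected (induced G {v, r})"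
      using Qv[OF r] adjacent_sym[of G v r] BV
      by (intro connected_clique) (auto simp: clique_def B_def)
    have upm: "graph_connected (induced G (insert mp {u, p}))"
      using mp BV by (intro connected_insert[OF up _ _ mp(2)]) (auto simp: B_def M_def)
    have vrm: "graph_connected (induced G (insert mr {v, r}))"
      using mr BV by (intro connected_insert[OF vr _ _ mr(2)]) (auto simp: B_def M_def)
    show ?thesis
    proof (cases "T \<inter> M = {}")
      case True
      have "T \<subseteq> X \<or> T \<subseteq> Y"
      proof (cases "T \<inter> X = {}")
        case True
        then show ?thesis using \<open>T \<inter> M = {}\<close> TV by (auto simp: M_def)
      next
        case False
        then obtain t where "t \<in> X" "t \<in> T" by auto
        then have "T \<subseteq> X"
          by (rule connected_closed[OF Tc TV])
            (use noXY \<open>T \<inter> M = {}\<close> TV in \<open>auto simp: M_def\<close>)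
        then show ?thesis ..
      qed
      then have False
      proof
        assume TX: "T \<subseteq> X"
        \<comment> \<open>Here \<open>T\<close> weighs at most \<open>2 + 2 * \<tau>\<close>,
          against \<open>2 + 5 * \<tau>\<close> for the opposite pair with
          \<open>mr\<close>.\<close>
        have "sum w T \<le> sum w {u, p} + \<tau>"
          using TX XV BX by (intro bound_M) (auto simp: B_def M_def)
        moreover have "sum w (insert mr {v, r}) \<le> sum w T"
          using TX mr vX r QY XY BV by (intro T_bound[OF vrm]) (auto simp: M_def B_def)
        moreover have "mr \<noteq> v" "mr \<noteq> r" using mr BM by (auto simp: B_def)
        ultimately show False using wB wM[OF mr(1)] distinct \<tau> by simp
      next
        assume TY: "T \<subseteq> Y"
        have "sum w T \<le> sum w {r, v} + \<tau>"
          using TY YV BY by (intro bound_M) (auto simp: B_def M_def)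
        moreover have "sum w (insert mp {u, p}) \<le> sum w T"
          using TY mp uY p PX XY BV by (intro T_bound[OF upm]) (auto simp: M_def B_def)
        moreover have "mp \<noteq> u" "mp \<noteq> p" using mp BM by (auto simp: B_def)
        ultimately show False using wB wM[OF mp(1)] distinct \<tau> by simp
      qed
      then show ?thesis ..
    next
      case False
      then obtain m where m: "m \<in> T" "m \<in> M" by auto
      show ?thesis
      \<comment> \<open>With at most one heavy vertex \<open>T\<close> weighs less than 2, yet one
        of the edges \<open>{u, p}\<close> and \<open>{v, r}\<close>, of weight
        \<open>2 + \<tau>\<close>, lies outside it.\<close>
      proof (cases "\<exists>a\<in>B. T \<inter> B \<subseteq> {a}")
        case True
        then obtain a where a: "a \<in> B" "T \<inter> B \<subseteq> {a}" by auto
        have "sum w T \<le> sum w {a} + 1 / 4" using a TV by (intro bound) auto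
        then have "sum w T < 2" using wB2[OF a(1)] \<tau> \<epsilon> by simp
        moreover have "{u, p} \<inter> T = {} \<or> {v, r} \<inter> T = {}"
          using a distinct by (auto simp: B_def)
        then have "sum w {u, p} \<le> sum w T \<or> sum w {v, r} \<le> sum w T"
          using T_bound[OF up] T_bound[OF vr] BV by (auto simp: B_def)
        ultimately show ?thesis using wB distinct \<tau> by auto
      next
        case False
        then obtain a where a: "a \<in> T" "a \<in> B" by (auto simp: B_def)
        then obtain b where b: "b \<in> T" "b \<in> B" "a \<noteq> b" using False by blast
        have "m \<noteq> a" "m \<noteq> b" using a b m BM by auto
        then have "w a + w b + w m \<le> sum w T"
          using triple[OF a(1) b(1) m(1) TV] b(3) by simp
        then show ?thesis using wB1[OF a(2)] wB1[OF b(2)] wM[OF m(2)] \<tau> by simp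
      qed
    qed
  qed
  ultimately have "safe_number G w \<noteq> connected_safe_number G w"
    unfolding safe_numbers_eq_iff[OF G(1,2)] by fastforce
  then show ?thesis using wpos by auto
qed

theorem theorem1p3:
  fixes G :: "'a graph"
  assumes "simple_graph G" and "graph_connected G" and "chordal G"
  shows "((\<exists>K. dominating_clique G K) \<longleftrightarrow> graph_diam G \<le> 3)
       \<and> (graph_diam G \<le> 3 \<longleftrightarrow> G \<in> Gcs)"
proof (intro conjI iffI)
  note diam = dominating_clique_iff_diam[OF assms]
  show "graph_diam G \<le> 3" if "\<exists>K. dominating_clique G K" using that diam by simp
  show "\<exists>K. dominating_clique G K" if "graph_diam G \<le> 3" using that diam by simp
  show "G \<in> Gcs" if "graph_diam G \<le> 3"
  proof -
    obtain K where "dominating_clique G K" using \<open>graph_diam G \<le> 3\<close> diam by auto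
    then show ?thesis
      using dominating_clique_connected_safe_set[OF assms] assms(1)
      by (simp add: Gcs_def safe_numbers_eq_iff[OF assms(1,2)])
  qed
  show "graph_diam G \<le> 3" if "G \<in> Gcs"
  proof (rule ccontr)
    assume "\<not> graph_diam G \<le> 3"
    then obtain u v where "u \<in> verts G" "v \<in> verts G"
      "\<not> touching G (closed_nbhd G u) (closed_nbhd G v)"
      using graph_diam_le_3_iff[OF assms(1,2)] by auto
    then show False
      using far_vertices_unsafe_weight[OF assms] \<open>G \<in> Gcs\<close> by (auto simp: Gcs_def)
  qed
qed

end
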